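(* Let $G=(V,E)$ be a connected locally finite graph with symmetric positive edge weights $\omega_{xy}=\omega_{yx}>0$ ($xy\in E$) and measure $\mu:V\to(0,\infty)$ with $\mu(x)\ge\mu_{\min}>0$ for all $x\in V$. Assume $a:V\to\mathbb{R}$ satisfies: $(A_1)$ $\inf_{x\in V}a(x)\ge a_0$ for some constant $a_0\in(-1,0)$; $(A_2')$ there exists $M_0>0$ such that $1/a(x)\in L^1(V\setminus D_{M_0})$, where $D_{M_0}=\{x\in V: a(x)\le M_0\}$, and the volume $\sum_{x\in D_{M_0}}\mu(x)$ of $D_{M_0}$ is finite. Then $\mathcal H$ is weakly pre-compact (every bounded sequence in $\mathcal H$ has a subsequence converging weakly to an element of $\mathcal H$), and $\mathcal H$ is compactly embedded into $L^p(V)$ for all $1\le p\le+\infty$.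
   Context: A graph is locally finite if every vertex has finitely many neighbours; write $y\sim x$ if $xy\in E$. For $u,v:V\to\mathbb{R}$: $\int_V u\,d\mu=\sum_{x\in V}\mu(x)u(x)$; $\Gamma(u,v)(x)=\frac1{2\mu(x)}\sum_{y\sim x}\omega_{xy}(u(y)-u(x))(v(y)-v(x))$; $|\nabla u|^2=\Gamma(u,u)$. $L^p(V)$ has norm $\left(\int_V|u|^p\,d\mu\right)^{1/p}$ for $1\le p<\infty$ and $\sup_{x\in V}|u(x)|$ for $p=\infty$. $C_c(V)$ is the set of functions with finite support, and $H^1(V)$ is the completion of $C_c(V)$ under $\|u\|_{H^1(V)}=\left(\int_V(|\nabla u|^2+u^2)\,d\mu\right)^{1/2}$ (regarded as a space of functions on $V$). $\mathcal H=\{u\in H^1(V):\int_V a(x)u^2\,d\mu<+\infty\}$ is the Hilbert space with inner product $\langle u,v\rangle_{\mathcal H}=\int_V(\Gamma(u,v)+(a(x)+1)uv)\,d\mu$ and induced norm $\|\cdot\|_{\mathcal H}$. *)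

theory Defs
  imports "HOL-Analysis.Analysis"
begin

text \<open>
  The vertex set is the whole type \<open>'v\<close>. A graph is given by its symmetric adjacency relation
  \<open>E\<close>, so \<open>(x, y) \<in> E\<close> means \<open>y \<sim> x\<close>. Only the values of the weight \<open>\<omega>\<close> on \<open>E\<close> matter.
\<close>

section \<open>Integration and \<open>L\<^sup>p\<close> spaces\<close>

text \<open>
  For real-valued families, unconditional summability coincides with absolute summability, so
  \<open>summable_on\<close> expresses integrability. The unconditional sum of a family that is not
  summable is \<open>0\<close>; hence finiteness of an integral is always stated by \<open>integrable_V\<close>.
\<close>

definition integrable_V :: "('v \<Rightarrow> real) \<Rightarrow> 'v set \<Rightarrow> ('v \<Rightarrow> real) \<Rightarrow> bool" where
  "integrable_V \<mu> S u \<longleftrightarrow> (\<lambda>x. \<mu> x * u x) summable_on S"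

definition integral_V :: "('v \<Rightarrow> real) \<Rightarrow> 'v set \<Rightarrow> ('v \<Rightarrow> real) \<Rightarrow> real" where
  "integral_V \<mu> S u = (\<Sum>\<^sub>\<infinity>x\<in>S. \<mu> x * u x)"

definition Lp_space :: "('v \<Rightarrow> real) \<Rightarrow> 'v set \<Rightarrow> ereal \<Rightarrow> ('v \<Rightarrow> real) set" where
  "Lp_space \<mu> S p =
     (if p = \<infinity> then {u. bdd_above ((\<lambda>x. \<bar>u x\<bar>) ` S)}
      else {u. integrable_V \<mu> S (\<lambda>x. \<bar>u x\<bar> powr real_of_ereal p)})"

definition Lp_norm :: "('v \<Rightarrow> real) \<Rightarrow> 'v set \<Rightarrow> ereal \<Rightarrow> ('v \<Rightarrow> real) \<Rightarrow> real" where
  "Lp_norm \<mu> S p u =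
     (if p = \<infinity> then (SUP x\<in>S. \<bar>u x\<bar>)
      else integral_V \<mu> S (\<lambda>x. \<bar>u x\<bar> powr real_of_ereal p) powr (1 / real_of_ereal p))"

section \<open>Gradient form and Sobolev spaces\<close>

definition Gamma ::
  "('v \<times> 'v) set \<Rightarrow> ('v \<Rightarrow> 'v \<Rightarrow> real) \<Rightarrow> ('v \<Rightarrow> real) \<Rightarrow> ('v \<Rightarrow> real) \<Rightarrow> ('v \<Rightarrow> real) \<Rightarrow> 'v \<Rightarrow> real"
  where
  "Gamma E \<omega> \<mu> u v x =
     1 / (2 * \<mu> x) * (\<Sum>y\<in>E `` {x}. \<omega> x y * (u y - u x) * (v y - v x))"

definition Cc :: "('v \<Rightarrow> real) set" where
  "Cc = {u. finite {x. u x \<noteq> 0}}"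

definition H1_norm ::
  "('v \<times> 'v) set \<Rightarrow> ('v \<Rightarrow> 'v \<Rightarrow> real) \<Rightarrow> ('v \<Rightarrow> real) \<Rightarrow> ('v \<Rightarrow> real) \<Rightarrow> real" where
  "H1_norm E \<omega> \<mu> u = sqrt (integral_V \<mu> UNIV (\<lambda>x. Gamma E \<omega> \<mu> u u x + (u x)\<^sup>2))"

text \<open>
  The completion of \<open>Cc\<close>, as a space of functions: when \<open>\<mu>\<close> is bounded away from \<open>0\<close>, a sequence
  that is Cauchy for \<open>H1_norm\<close> converges pointwise, and two such sequences represent the same
  element of the completion iff they have the same pointwise limit. The element is identified
  with that limit.
\<close>

definition H1 ::
  "('v \<times> 'v) set \<Rightarrow> ('v \<Rightarrow> 'v \<Rightarrow> real) \<Rightarrow> ('v \<Rightarrow> real) \<Rightarrow> ('v \<Rightarrow> real) set" where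
  "H1 E \<omega> \<mu> =
     {u. \<exists>\<phi> :: nat \<Rightarrow> 'v \<Rightarrow> real.
           (\<forall>n. \<phi> n \<in> Cc) \<and>
           (\<forall>e>0. \<exists>N. \<forall>m\<ge>N. \<forall>n\<ge>N. H1_norm E \<omega> \<mu> (\<lambda>x. \<phi> m x - \<phi> n x) < e) \<and>
           (\<forall>x. (\<lambda>n. \<phi> n x) \<longlonglongrightarrow> u x)}"

definition H_space ::
  "('v \<times> 'v) set \<Rightarrow> ('v \<Rightarrow> 'v \<Rightarrow> real) \<Rightarrow> ('v \<Rightarrow> real) \<Rightarrow> ('v \<Rightarrow> real) \<Rightarrow> ('v \<Rightarrow> real) set" where
  "H_space E \<omega> \<mu> a = {u \<in> H1 E \<omega> \<mu>. integrable_V \<mu> UNIV (\<lambda>x. a x * (u x)\<^sup>2)}"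

definition H_inner ::
  "('v \<times> 'v) set \<Rightarrow> ('v \<Rightarrow> 'v \<Rightarrow> real) \<Rightarrow> ('v \<Rightarrow> real) \<Rightarrow> ('v \<Rightarrow> real) \<Rightarrow>
   ('v \<Rightarrow> real) \<Rightarrow> ('v \<Rightarrow> real) \<Rightarrow> real" where
  "H_inner E \<omega> \<mu> a u v =
     integral_V \<mu> UNIV (\<lambda>x. Gamma E \<omega> \<mu> u v x + (a x + 1) * u x * v x)"

definition H_norm ::
  "('v \<times> 'v) set \<Rightarrow> ('v \<Rightarrow> 'v \<Rightarrow> real) \<Rightarrow> ('v \<Rightarrow> real) \<Rightarrow> ('v \<Rightarrow> real) \<Rightarrow> ('v \<Rightarrow> real) \<Rightarrow> real" where
  "H_norm E \<omega> \<mu> a u = sqrt (H_inner E \<omega> \<mu> a u u)"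

section \<open>Weak convergence and compact embeddings\<close>

text \<open>
  Below, \<open>X\<close> is a linear space of real functions on \<open>'v\<close> and \<open>N\<close> is a norm on it; functionals are
  total functions of which only the values on \<open>X\<close> are used.
\<close>

definition bounded_functional_on ::
  "('v \<Rightarrow> real) set \<Rightarrow> (('v \<Rightarrow> real) \<Rightarrow> real) \<Rightarrow> (('v \<Rightarrow> real) \<Rightarrow> real) \<Rightarrow> bool" where
  "bounded_functional_on X N F \<longleftrightarrow>
     (\<forall>u\<in>X. \<forall>v\<in>X. F (\<lambda>x. u x + v x) = F u + F v) \<and>
     (\<forall>c. \<forall>u\<in>X. F (\<lambda>x. c * u x) = c * F u) \<and>
     (\<exists>C. \<forall>u\<in>X. \<bar>F u\<bar> \<le> C * N u)"

definition weakly_converges_in ::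
  "('v \<Rightarrow> real) set \<Rightarrow> (('v \<Rightarrow> real) \<Rightarrow> real) \<Rightarrow> (nat \<Rightarrow> 'v \<Rightarrow> real) \<Rightarrow> ('v \<Rightarrow> real) \<Rightarrow> bool" where
  "weakly_converges_in X N u l \<longleftrightarrow>
     (\<forall>F. bounded_functional_on X N F \<longrightarrow> (\<lambda>n. F (u n)) \<longlonglongrightarrow> F l)"

definition bounded_seq_in ::
  "('v \<Rightarrow> real) set \<Rightarrow> (('v \<Rightarrow> real) \<Rightarrow> real) \<Rightarrow> (nat \<Rightarrow> 'v \<Rightarrow> real) \<Rightarrow> bool" where
  "bounded_seq_in X N u \<longleftrightarrow> (\<forall>n. u n \<in> X) \<and> (\<exists>C. \<forall>n. N (u n) \<le> C)"

definition weakly_precompact ::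
  "('v \<Rightarrow> real) set \<Rightarrow> (('v \<Rightarrow> real) \<Rightarrow> real) \<Rightarrow> bool" where
  "weakly_precompact X N \<longleftrightarrow>
     (\<forall>u. bounded_seq_in X N u \<longrightarrow>
        (\<exists>r l. strict_mono r \<and> l \<in> X \<and> weakly_converges_in X N (u \<circ> r) l))"

definition compactly_embedded ::
  "('v \<Rightarrow> real) set \<Rightarrow> (('v \<Rightarrow> real) \<Rightarrow> real) \<Rightarrow>
   ('v \<Rightarrow> real) set \<Rightarrow> (('v \<Rightarrow> real) \<Rightarrow> real) \<Rightarrow> bool" where
  "compactly_embedded X N Y M \<longleftrightarrow>
     X \<subseteq> Y \<and>
     (\<exists>C. \<forall>u\<in>X. M u \<le> C * N u) \<and>
     (\<forall>u. bounded_seq_in X N u \<longrightarrow>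
        (\<exists>r l. strict_mono r \<and> l \<in> Y \<and> (\<lambda>n. M (\<lambda>x. (u \<circ> r) n x - l x)) \<longlonglongrightarrow> 0))"

end

theory Submission
  imports Defs "HOL-Complex_Analysis.Great_Picard"
begin

text \<open>
  The key quantity is the weight \<open>\<mu> / (a + 1)\<close>. A set of finite volume is finite, because every vertex
  has measure at least \<open>\<mu>_min\<close>; on the finite set where \<open>a \<le> M0\<close> the weight is trivially summable, and
  elsewhere it is at most \<open>\<mu> / a\<close>, so it is summable on all of \<open>V\<close>
  (\<open>finite_volume_sublevel_imp_summable\<close>). Cauchy-Schwarz gives, for every set \<open>A\<close> of vertices,
  \<open>(\<Sum>\<^sub>A \<mu> \<bar>u\<bar>)\<^sup>2 \<le> (\<Sum>\<^sub>A \<mu> / (a + 1)) \<cdot> \<parallel>u\<parallel>\<^sub>\<H>\<^sup>2\<close> (\<open>L1_le_H_norm\<close>). With \<open>A\<close> the whole vertex set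
  this embeds \<open>\<H>\<close> into \<open>L\<^sup>1\<close>; with \<open>A\<close> the complement of a large finite set it makes the
  \<open>L\<^sup>1\<close> tails of a bounded family uniformly small. Hence a bounded sequence in \<open>\<H>\<close> that tends to \<open>0\<close>
  pointwise tends to \<open>0\<close> in \<open>L\<^sup>1\<close> (\<open>pointwise_null_imp_L1_null\<close>). The exponent \<open>p\<close> is then irrelevant:
  as the atoms are bounded below, \<open>\<parallel>u\<parallel>\<^sub>\<infinity> \<le> \<parallel>u\<parallel>\<^sub>1 / \<mu>_min\<close>, and
  \<open>\<parallel>u\<parallel>\<^sub>p\<^sup>p \<le> \<parallel>u\<parallel>\<^sub>\<infinity>\<^bsup>p-1\<^esup> \<parallel>u\<parallel>\<^sub>1\<close> bounds every \<open>L\<^sup>p\<close> norm by the \<open>L\<^sup>1\<close> norm (\<open>L1_imp_Lp\<close>).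
  
  Summability of a positive weight also makes \<open>V\<close> countable, so a diagonal argument extracts from each
  bounded sequence a pointwise convergent subsequence (\<open>bounded_seq_pointwise_subseq\<close>). What remains is
  that its pointwise limit lies in \<open>\<H>\<close> and is its weak limit. This holds in any Hilbert space of
  functions in which Cauchy sequences converge to their pointwise limits
  (\<open>pointwise_limit_is_weak_limit\<close>), and it needs no representation of the dual space: almost norm-minimal
  averages of the tails of a bounded sequence are Cauchy by the parallelogram law, and they have the same
  pointwise limit as the sequence (\<open>mazur_midpoints\<close>). So the limit lies in the space; and a functional
  that stays above \<open>\<epsilon> > 0\<close> along a bounded pointwise null sequence would stay above \<open>\<epsilon>\<close> on averages
  whose norms tend to \<open>0\<close>.
  
  The space \<open>\<H>\<close> is of this kind because its norm is a sum of nonnegative densities, each depending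
  continuously on finitely many values of \<open>u\<close>: Fatou's lemma turns Cauchy sequences with a pointwise
  limit into norm convergent ones (\<open>energy_limit\<close>, \<open>H_space_complete\<close>).
\<close>

section \<open>Hilbert spaces of functions\<close>

text \<open>
  The Hilbert structure enters only through the parallelogram law, and completeness is stated relative
  to the pointwise limit, so that limits are actual functions and not classes of sequences.
\<close>

locale hilbert_function_space =
  fixes X :: "('v \<Rightarrow> real) set" and N :: "('v \<Rightarrow> real) \<Rightarrow> real"
  assumes add_mem: "\<lbrakk>u \<in> X; v \<in> X\<rbrakk> \<Longrightarrow> (\<lambda>x. u x + v x) \<in> X"
    and scale_mem: "u \<in> X \<Longrightarrow> (\<lambda>x. c * u x) \<in> X"
    and norm_nonneg: "u \<in> X \<Longrightarrow> 0 \<le> N u"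
    and norm_scale: "u \<in> X \<Longrightarrow> N (\<lambda>x. c * u x) = \<bar>c\<bar> * N u"
    and parallelogram: "\<lbrakk>u \<in> X; v \<in> X\<rbrakk> \<Longrightarrow>
      (N (\<lambda>x. u x + v x))\<^sup>2 + (N (\<lambda>x. u x - v x))\<^sup>2 = 2 * (N u)\<^sup>2 + 2 * (N v)\<^sup>2"
    and complete: "\<lbrakk>\<And>n::nat. s n \<in> X;
      \<And>e. e > 0 \<Longrightarrow> \<exists>M. \<forall>m\<ge>M. \<forall>n\<ge>M. N (\<lambda>x. s m x - s n x) < e;
      \<And>x. (\<lambda>n. s n x) \<longlonglongrightarrow> l x\<rbrakk> \<Longrightarrow> l \<in> X \<and> (\<lambda>n. N (\<lambda>x. s n x - l x)) \<longlonglongrightarrow> 0"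
begin

lemma diff_mem: "\<lbrakk>u \<in> X; v \<in> X\<rbrakk> \<Longrightarrow> (\<lambda>x. u x - v x) \<in> X"
  using add_mem[of u "\<lambda>x. -1 * v x"] scale_mem[of v "-1"] by simp

lemma norm_diff_commute:
  assumes "u \<in> X" "v \<in> X"
  shows "N (\<lambda>x. u x - v x) = N (\<lambda>x. v x - u x)"
  using norm_scale[OF diff_mem[OF assms], of "-1"] by simp

lemma midpoint_mem: "\<lbrakk>u \<in> X; v \<in> X\<rbrakk> \<Longrightarrow> (\<lambda>x. (u x + v x) / 2) \<in> X"
  using scale_mem[OF add_mem, of u v "1/2"] by simp

lemma norm_midpoint: "\<lbrakk>u \<in> X; v \<in> X\<rbrakk> \<Longrightarrow> N (\<lambda>x. (u x + v x) / 2) = N (\<lambda>x. u x + v x) / 2"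
  using norm_scale[OF add_mem, of u v "1/2"] by simp

lemma norm_diff_sq_le:
  assumes "u \<in> X" "v \<in> X"
  shows "(N (\<lambda>x. u x - v x))\<^sup>2 \<le> 2 * (N u)\<^sup>2 + 2 * (N v)\<^sup>2"
  using parallelogram[OF assms] zero_le_power2[of "N (\<lambda>x. u x + v x)"] by linarith

end

text \<open>
  Iterated midpoints replace convex combinations: the parallelogram law speaks about midpoints only,
  and pointwise closeness and lower bounds on a functional pass to them.
\<close>

inductive_set midpoint_hull :: "('v \<Rightarrow> real) set \<Rightarrow> ('v \<Rightarrow> real) set" for S where
  base: "u \<in> S \<Longrightarrow> u \<in> midpoint_hull S"
| midpoint: "\<lbrakk>u \<in> midpoint_hull S; v \<in> midpoint_hull S\<rbrakk>
    \<Longrightarrow> (\<lambda>x. (u x + v x) / 2) \<in> midpoint_hull S"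

lemma midpoint_hull_mono: "S \<subseteq> T \<Longrightarrow> midpoint_hull S \<subseteq> midpoint_hull T"
proof
  fix u assume "S \<subseteq> T" "u \<in> midpoint_hull S"
  from this(2,1) show "u \<in> midpoint_hull T"
    by (induction rule: midpoint_hull.induct) (auto intro: midpoint_hull.intros)
qed

text \<open>
  Averages of a tail stay as close to the pointwise limit as the tail does.
\<close>

lemma midpoint_hull_pointwise_close:
  assumes "u \<in> midpoint_hull S" "\<And>s. s \<in> S \<Longrightarrow> \<bar>s x - c\<bar> \<le> e"
  shows "\<bar>u x - c\<bar> \<le> e"
  using assms
proof (induction rule: midpoint_hull.induct)
  case (midpoint u v)
  have "(u x + v x) / 2 - c = ((u x - c) + (v x - c)) / 2" by (simp add: field_simps)
  moreover have "\<bar>u x - c\<bar> \<le> e" "\<bar>v x - c\<bar> \<le> e" using midpoint by auto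
  ultimately show ?case unfolding abs_le_iff by (simp add: field_simps)
qed auto

context hilbert_function_space
begin

lemma midpoint_hull_mem:
  assumes "u \<in> midpoint_hull S" "S \<subseteq> X"
  shows "u \<in> X"
  using assms by (induction rule: midpoint_hull.induct) (auto intro: midpoint_mem)

text \<open>
  A form of Mazur's lemma. Let \<open>d n\<close> be the infimum of the squared norms of averages of the functions
  from index \<open>n\<close> on. It increases with \<open>n\<close> and is bounded, so it converges; almost minimal
  averages \<open>v n\<close> are therefore Cauchy, since the midpoint of \<open>v m\<close> and \<open>v n\<close> is again an average of
  the tail from \<open>min m n\<close> and cannot have much smaller norm than both.
\<close>

lemma mazur_midpoints:
  assumes u: "\<And>n::nat. u n \<in> X" and bound: "\<And>n. N (u n) \<le> C"
    and lim: "\<And>x. (\<lambda>n. u n x) \<longlonglongrightarrow> l x"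
  shows "l \<in> X"
    and "\<exists>v. (\<forall>n. v n \<in> midpoint_hull (u ` {n..})) \<and> (\<lambda>n. N (\<lambda>x. v n x - l x)) \<longlonglongrightarrow> 0"
proof -
  define K where "K n = midpoint_hull (u ` {n..})" for n
  have KX: "w \<in> X" if "w \<in> K n" for w n
    using midpoint_hull_mem[of w "u ` {n..}"] that u by (auto simp: K_def)
  have K_anti: "K n \<subseteq> K m" if "m \<le> n" for m n
    unfolding K_def using that by (intro midpoint_hull_mono) auto
  have uK: "u n \<in> K n" for n
    unfolding K_def by (intro midpoint_hull.base) auto
  define \<eta> where "\<eta> n = inverse (real (Suc n))" for n
  define d where "d n = (INF w\<in>K n. (N w)\<^sup>2)" for n
  have bdd: "bdd_below ((\<lambda>w. (N w)\<^sup>2) ` K n)" for n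
    by (rule bdd_belowI2[of _ 0]) auto
  have d_le: "d n \<le> (N w)\<^sup>2" if "w \<in> K n" for n w
    unfolding d_def using bdd that by (rule cINF_lower)
  have "d n \<le> C\<^sup>2" for n
    using d_le[OF uK] power_mono[OF bound norm_nonneg[OF u], of n 2] by (meson order_trans)
  moreover have d_mono: "d m \<le> d n" if "m \<le> n" for m n
    unfolding d_def using uK[of n] K_anti[OF that] bdd by (intro cINF_superset_mono) auto
  ultimately have "convergent d"
    by (metis convergentI incseq_convergent monoI)
  then have d_Cauchy: "Cauchy d" by (simp add: Cauchy_convergent_iff)
  have "\<exists>w\<in>K n. (N w)\<^sup>2 < d n + \<eta> n" for n
  proof -
    have "Inf ((\<lambda>w. (N w)\<^sup>2) ` K n) < d n + \<eta> n" by (simp add: d_def \<eta>_def)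
    from cInf_lessD[OF _ this] uK show ?thesis by auto
  qed
  then obtain v where vK: "\<And>n. v n \<in> K n"
    and v_min: "\<And>n. (N (v n))\<^sup>2 < d n + \<eta> n" by metis
  have vX: "v n \<in> X" for n using KX vK by blast
  have v_diff: "(N (\<lambda>x. v m x - v n x))\<^sup>2 \<le> 2 * (d n - d m) + 4 * \<eta> m"
    if "m \<le> n" for m n
  proof -
    \<comment> \<open>The midpoint competes in the infimum defining \<open>d m\<close>; the parallelogram law does the rest.\<close>
    have "(\<lambda>x. (v m x + v n x) / 2) \<in> K m"
      using vK[of m] vK[of n] K_anti[OF that] unfolding K_def by (intro midpoint_hull.midpoint) auto
    then have "d m \<le> (N (\<lambda>x. (v m x + v n x) / 2))\<^sup>2" by (rule d_le)
    also have "\<dots> = (N (\<lambda>x. v m x + v n x))\<^sup>2 / 4"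
      by (simp add: norm_midpoint vX power_divide)
    finally have "4 * d m \<le> (N (\<lambda>x. v m x + v n x))\<^sup>2" by simp
    moreover have "\<eta> n \<le> \<eta> m" using that by (simp add: \<eta>_def field_simps)
    ultimately show ?thesis
      using parallelogram[OF vX vX, of m n] v_min[of m] v_min[of n] by argo
  qed
  have v_Cauchy: "\<exists>M. \<forall>m\<ge>M. \<forall>n\<ge>M. N (\<lambda>x. v m x - v n x) < e" if "e > 0" for e
  proof -
    have "e\<^sup>2 > 0" using that by simp
    obtain M1 where M1: "\<And>m n. m \<ge> M1 \<Longrightarrow> n \<ge> M1 \<Longrightarrow> \<bar>d m - d n\<bar> < e\<^sup>2 / 4"
      using CauchyD[OF d_Cauchy, of "e\<^sup>2/4"] \<open>e\<^sup>2 > 0\<close> by auto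
    obtain M2 where M2: "\<eta> M2 < e\<^sup>2 / 8"
      using reals_Archimedean[of "e\<^sup>2 / 8"] \<open>e\<^sup>2 > 0\<close> by (auto simp: \<eta>_def)
    have ord: "N (\<lambda>x. v m x - v n x) < e" if "m \<ge> max M1 M2" "m \<le> n" for m n
    proof -
      have "\<eta> m \<le> \<eta> M2" using that by (simp add: \<eta>_def field_simps)
      moreover have "d n - d m < e\<^sup>2 / 4" 
        by (rule le_less_trans[OF abs_ge_self M1]) (use that in auto)
      ultimately have "(N (\<lambda>x. v m x - v n x))\<^sup>2 < e\<^sup>2"
        using v_diff[OF that(2)] M2 by argo
      then show ?thesis using \<open>e > 0\<close> by (rule power2_less_imp_less[OF _ less_imp_le])
    qed
    have "N (\<lambda>x. v m x - v n x) < e" if "m \<ge> max M1 M2" "n \<ge> max M1 M2" for m n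
      using ord[of m n] ord[of n m] that norm_diff_commute[OF vX vX, of m n] by linarith
    then show ?thesis by blast
  qed
  have v_lim: "(\<lambda>n. v n x) \<longlonglongrightarrow> l x" for x
  proof (rule LIMSEQ_I)
    fix r :: real assume "r > 0"
    then obtain M where M: "\<And>n. n \<ge> M \<Longrightarrow> \<bar>u n x - l x\<bar> < r/2"
      using LIMSEQ_D[OF lim[of x], of "r/2"] by auto
    have "\<bar>v n x - l x\<bar> \<le> r/2" if "n \<ge> M" for n
      using vK[of n] unfolding K_def
      by (rule midpoint_hull_pointwise_close) (use M that in \<open>auto intro: less_imp_le\<close>)
    then show "\<exists>no. \<forall>n\<ge>no. norm (v n x - l x) < r"
      using \<open>r > 0\<close> by (intro exI[of _ M]) fastforce
  qed
  have "l \<in> X \<and> (\<lambda>n. N (\<lambda>x. v n x - l x)) \<longlonglongrightarrow> 0"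
    using vX v_Cauchy v_lim by (rule complete)
  then show "l \<in> X"
    and "\<exists>v. (\<forall>n. v n \<in> midpoint_hull (u ` {n..})) \<and> (\<lambda>n. N (\<lambda>x. v n x - l x)) \<longlonglongrightarrow> 0"
    using vK unfolding K_def by blast+
qed

lemma functional_ge_on_midpoint_hull:
  assumes F: "bounded_functional_on X N F" and S: "S \<subseteq> X" "\<And>s. s \<in> S \<Longrightarrow> e \<le> F s"
    and u: "u \<in> midpoint_hull S"
  shows "e \<le> F u"
  using u
proof (induction rule: midpoint_hull.induct)
  case (midpoint u v)
  have uv: "u \<in> X" "v \<in> X" using midpoint S midpoint_hull_mem by blast+
  have "F (\<lambda>x. (1/2) * (u x + v x)) = (1/2) * F (\<lambda>x. u x + v x)"
    using F add_mem[OF uv] unfolding bounded_functional_on_def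
    by (elim conjE allE[of _ "1/2"] ballE[of _ _ "\<lambda>x. u x + v x"]) auto
  also have "F (\<lambda>x. u x + v x) = F u + F v"
    using F uv unfolding bounded_functional_on_def by blast
  finally have "F (\<lambda>x. (u x + v x) / 2) = (F u + F v) / 2" by simp
  then show ?case using midpoint.IH by simp
qed (use S in auto)

text \<open>
  Otherwise \<open>F \<ge> e\<close> along a subsequence, hence on all averages of it; but some of these averages tend
  to \<open>0\<close> in norm, where \<open>F\<close> is small.
\<close>

lemma functional_eventually_less:
  assumes F: "bounded_functional_on X N F"
    and u: "\<And>n::nat. u n \<in> X" and bound: "\<And>n. N (u n) \<le> C"
    and lim: "\<And>x. (\<lambda>n. u n x) \<longlonglongrightarrow> 0" and "e > 0"
  shows "\<forall>\<^sub>F n in sequentially. F (u n) < e"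
proof (rule ccontr)
  assume "\<not> ?thesis"
  then have "\<exists>\<^sub>F n in sequentially. e \<le> F (u n)"
    by (simp add: frequently_def not_le)
  then have "infinite {n. e \<le> F (u n)}"
    by (simp add: frequently_cofinite[symmetric] cofinite_eq_sequentially)
  then obtain r :: "nat \<Rightarrow> nat" where r: "strict_mono r" "\<And>n. e \<le> F (u (r n))"
    using infinite_enumerate by (metis mem_Collect_eq)
  have rlim: "(\<lambda>n. u (r n) x) \<longlonglongrightarrow> 0" for x
    using LIMSEQ_subseq_LIMSEQ[OF lim r(1)] by (simp add: o_def)
  obtain v where v: "\<And>n. v n \<in> midpoint_hull ((\<lambda>n. u (r n)) ` {n..})"
    and v0: "(\<lambda>n. N (\<lambda>x. v n x - 0)) \<longlonglongrightarrow> 0"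
    using mazur_midpoints(2)[of "\<lambda>n. u (r n)" C "\<lambda>_. 0", OF u bound rlim] by blast
  obtain B where B: "\<And>w. w \<in> X \<Longrightarrow> \<bar>F w\<bar> \<le> B * N w"
    using F unfolding bounded_functional_on_def by blast
  have "e \<le> B * N (v n)" for n
  proof -
    have sub: "(\<lambda>n. u (r n)) ` {n..} \<subseteq> X" using u by auto
    have "e \<le> F (v n)"
      using functional_ge_on_midpoint_hull[OF F sub _ v] r(2) by auto
    then show ?thesis using B[OF midpoint_hull_mem[OF v sub]] by linarith
  qed
  moreover have "(\<lambda>n. B * N (v n)) \<longlonglongrightarrow> B * 0"
    using v0 by (intro tendsto_mult tendsto_const) simp
  ultimately have "e \<le> B * 0"
    using LIMSEQ_le_const by blast
  then show False using \<open>e > 0\<close> by simp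
qed

text \<open>
  The one-sided estimate for null sequences, applied to \<open>F\<close> and to \<open>- F\<close>.
\<close>

theorem pointwise_limit_is_weak_limit:
  assumes u: "\<And>n::nat. u n \<in> X" and bound: "\<And>n. N (u n) \<le> C"
    and lim: "\<And>x. (\<lambda>n. u n x) \<longlonglongrightarrow> l x"
  shows "l \<in> X" "weakly_converges_in X N u l"
proof -
  show l: "l \<in> X" using mazur_midpoints(1)[of u C l, OF u bound lim] .
  define w where "w n = (\<lambda>x. u n x - l x)" for n
  have w: "w n \<in> X" for n
    unfolding w_def by (intro diff_mem u l)
  have w_bound: "N (w n) \<le> sqrt (2 * C\<^sup>2 + 2 * (N l)\<^sup>2)" for n
  proof (rule real_le_rsqrt)
    have "(N (u n))\<^sup>2 \<le> C\<^sup>2" by (rule power_mono[OF bound norm_nonneg[OF u]])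
    then show "(N (w n))\<^sup>2 \<le> 2 * C\<^sup>2 + 2 * (N l)\<^sup>2"
      using norm_diff_sq_le[OF u l, of n] by (simp add: w_def)
  qed
  have w_lim: "(\<lambda>n. w n x) \<longlonglongrightarrow> 0" for x
    unfolding w_def using lim[of x] by (rule LIM_zero)
  show "weakly_converges_in X N u l"
    unfolding weakly_converges_in_def
  proof (intro allI impI)
    fix F assume F: "bounded_functional_on X N F"
    have F_neg: "bounded_functional_on X N (\<lambda>u. - F u)"
      using F unfolding bounded_functional_on_def by simp
    have Fw: "F (w n) = F (u n) - F l" for n
    proof -
      have "F (\<lambda>x. w n x + l x) = F (w n) + F l"
        using F w l unfolding bounded_functional_on_def by blast
      then show ?thesis by (simp add: w_def)
    qed
    have "(\<lambda>n. F (u n) - F l) \<longlonglongrightarrow> 0"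
    proof (rule tendstoI)
      fix e :: real assume "e > 0"
      show "\<forall>\<^sub>F n in sequentially. dist (F (u n) - F l) 0 < e"
        using functional_eventually_less[OF F w w_bound w_lim \<open>e > 0\<close>]
          functional_eventually_less[OF F_neg w w_bound w_lim \<open>e > 0\<close>]
        by eventually_elim (auto simp: Fw abs_less_iff)
    qed
    then show "(\<lambda>n. F (u n)) \<longlonglongrightarrow> F l" by (rule LIM_zero_cancel)
  qed
qed

end

section \<open>Sums of nonnegative families\<close>

lemma summable_on_bounded_sums:
  fixes f :: "'v \<Rightarrow> real"
  assumes "\<And>x. 0 \<le> f x" "\<And>F. finite F \<Longrightarrow> F \<subseteq> A \<Longrightarrow> sum f F \<le> C"
  shows "f summable_on A" "infsum f A \<le> C"
proof -
  show "f summable_on A"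
    using assms by (intro nonneg_bdd_above_summable_on bdd_aboveI2[of _ _ C]) auto
  then show "infsum f A \<le> C" using assms by (intro infsum_le_finite_sums) auto
qed

text \<open>
  Fatou's lemma for the counting measure: every finite partial sum passes to the limit.
\<close>

lemma infsum_fatou:
  fixes f :: "nat \<Rightarrow> 'v \<Rightarrow> real"
  assumes nonneg: "\<And>n x. 0 \<le> f n x"
    and bound: "\<forall>\<^sub>F n in sequentially. f n summable_on UNIV \<and> infsum (f n) UNIV \<le> C"
    and lim: "\<And>x. (\<lambda>n. f n x) \<longlonglongrightarrow> g x"
  shows "g summable_on UNIV" "infsum g UNIV \<le> C"
proof -
  have g: "0 \<le> g x" for x
    by (rule LIMSEQ_le_const[OF lim]) (use nonneg in auto)
  have "sum g F \<le> C" if "finite F" for F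
  proof (rule tendsto_upperbound)
    show "(\<lambda>n. sum (f n) F) \<longlonglongrightarrow> sum g F" by (intro tendsto_sum lim)
    show "\<forall>\<^sub>F n in sequentially. sum (f n) F \<le> C"
      using bound
    proof eventually_elim
      case (elim n)
      then show ?case
        using finite_sum_le_infsum[of "f n" UNIV F] that nonneg by (meson order_trans subset_UNIV)
    qed
  qed simp
  then show "g summable_on UNIV" "infsum g UNIV \<le> C"
    using summable_on_bounded_sums[of g UNIV C] g by auto
qed

lemma finite_summable_on_ge:
  fixes f :: "'v \<Rightarrow> real"
  assumes "f summable_on A" "c > 0" "\<And>x. x \<in> A \<Longrightarrow> c \<le> f x"
  shows "finite A"
proof (rule ccontr)
  assume "infinite A"
  moreover have "(\<lambda>_. c) summable_on A"
    using assms by (intro summable_on_comparison_test[OF assms(1)]) auto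
  ultimately show False using infsum_diverge_constant[of A c] \<open>c > 0\<close> by simp
qed

section \<open>The energy of a function on a weighted graph\<close>

text \<open>
  The norms of \<open>H\<^sup>1\<close> and of \<open>\<H>\<close> are both of the form \<open>\<Sum> \<mu> (\<Gamma>(u,u) + b u\<^sup>2)\<close>, with \<open>b = 1\<close> and
  \<open>b = a + 1\<close>. The energy is therefore developed for an arbitrary nonnegative \<open>b\<close>.
\<close>

locale weighted_graph =
  fixes E :: "('v \<times> 'v) set" and \<omega> :: "'v \<Rightarrow> 'v \<Rightarrow> real" and \<mu> :: "'v \<Rightarrow> real"
  assumes sym_E: "sym E"
    and locally_finite: "finite (E `` {x})"
    and weight_pos: "(x, y) \<in> E \<Longrightarrow> \<omega> x y > 0"
    and measure_pos: "\<mu> x > 0"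
begin

lemma Gamma_nonneg: "0 \<le> Gamma E \<omega> \<mu> u u x"
proof -
  have "0 \<le> \<omega> x y * (u y - u x) * (u y - u x)" if "y \<in> E `` {x}" for y
    using weight_pos[of x y] that by (simp add: mult.assoc)
  then have "0 \<le> (\<Sum>y\<in>E `` {x}. \<omega> x y * (u y - u x) * (u y - u x))" by (rule sum_nonneg)
  then show ?thesis
    using measure_pos[of x] unfolding Gamma_def by simp
qed

lemma Gamma_scale: "Gamma E \<omega> \<mu> (\<lambda>x. c * u x) (\<lambda>x. c * u x) x = c\<^sup>2 * Gamma E \<omega> \<mu> u u x"
  unfolding Gamma_def sum_distrib_left
  by (rule sum.cong) (auto simp: power2_eq_square algebra_simps)

lemma Gamma_parallelogram:
  "Gamma E \<omega> \<mu> (\<lambda>x. u x + v x) (\<lambda>x. u x + v x) x + Gamma E \<omega> \<mu> (\<lambda>x. u x - v x) (\<lambda>x. u x - v x) x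
   = 2 * Gamma E \<omega> \<mu> u u x + 2 * Gamma E \<omega> \<mu> v v x"
  unfolding Gamma_def sum_distrib_left sum.distrib[symmetric]
  by (rule sum.cong) (auto simp: algebra_simps)

lemma Gamma_tendsto:
  assumes "\<And>x. (\<lambda>n::nat. v n x) \<longlonglongrightarrow> l x"
  shows "(\<lambda>n. Gamma E \<omega> \<mu> (v n) (v n) x) \<longlonglongrightarrow> Gamma E \<omega> \<mu> l l x"
  unfolding Gamma_def by (intro tendsto_intros assms)

definition energy_density :: "('v \<Rightarrow> real) \<Rightarrow> ('v \<Rightarrow> real) \<Rightarrow> 'v \<Rightarrow> real" where
  "energy_density b u x = \<mu> x * (Gamma E \<omega> \<mu> u u x + b x * (u x)\<^sup>2)"

abbreviation finite_energy :: "('v \<Rightarrow> real) \<Rightarrow> ('v \<Rightarrow> real) \<Rightarrow> bool" where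
  "finite_energy b u \<equiv> energy_density b u summable_on UNIV"

definition energy :: "('v \<Rightarrow> real) \<Rightarrow> ('v \<Rightarrow> real) \<Rightarrow> real" where
  "energy b u = infsum (energy_density b u) UNIV"

lemma energy_density_scale: "energy_density b (\<lambda>x. c * u x) x = c\<^sup>2 * energy_density b u x"
  unfolding energy_density_def Gamma_scale by (simp add: power_mult_distrib algebra_simps)

lemma energy_density_parallelogram:
  "energy_density b (\<lambda>x. u x + v x) x + energy_density b (\<lambda>x. u x - v x) x = 2 * energy_density b u x + 2 * energy_density b v x"
proof -
  have "energy_density b (\<lambda>x. u x + v x) x + energy_density b (\<lambda>x. u x - v x) x
    = \<mu> x * ((Gamma E \<omega> \<mu> (\<lambda>x. u x + v x) (\<lambda>x. u x + v x) x
        + Gamma E \<omega> \<mu> (\<lambda>x. u x - v x) (\<lambda>x. u x - v x) x)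
        + b x * ((u x + v x)\<^sup>2 + (u x - v x)\<^sup>2))"
    unfolding energy_density_def by (simp add: algebra_simps)
  also have "\<dots> = 2 * energy_density b u x + 2 * energy_density b v x"
    unfolding Gamma_parallelogram energy_density_def by (simp add: power2_eq_square algebra_simps)
  finally show ?thesis .
qed

lemma energy_density_tendsto:
  assumes "\<And>x. (\<lambda>n::nat. v n x) \<longlonglongrightarrow> l x"
  shows "(\<lambda>n. energy_density b (v n) x) \<longlonglongrightarrow> energy_density b l x"
  unfolding energy_density_def by (intro tendsto_intros Gamma_tendsto assms)

lemma finite_energy_scale: "finite_energy b u \<Longrightarrow> finite_energy b (\<lambda>x. c * u x)"
  unfolding energy_density_scale[abs_def] by (rule summable_on_cmult_right)

lemma energy_scale: "energy b (\<lambda>x. c * u x) = c\<^sup>2 * energy b u"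
  unfolding energy_def energy_density_scale[abs_def] by (rule infsum_cmult_right')

lemma Cc_diff: "u \<in> Cc \<Longrightarrow> v \<in> Cc \<Longrightarrow> (\<lambda>x. u x - v x) \<in> Cc"
  unfolding Cc_def by (auto intro: finite_subset[of _ "{x. u x \<noteq> 0} \<union> {x. v x \<noteq> 0}"])

lemma Cc_add: "u \<in> Cc \<Longrightarrow> v \<in> Cc \<Longrightarrow> (\<lambda>x. u x + v x) \<in> Cc"
  unfolding Cc_def by (auto intro: finite_subset[of _ "{x. u x \<noteq> 0} \<union> {x. v x \<noteq> 0}"])

lemma Cc_scale: "u \<in> Cc \<Longrightarrow> (\<lambda>x. c * u x) \<in> Cc"
  unfolding Cc_def by (auto intro: finite_subset[of _ "{x. u x \<noteq> 0}"])

text \<open>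
  The density of \<open>u\<close> vanishes off the support and its neighbours, a finite set by local finiteness.
\<close>

lemma Cc_finite_energy:
  assumes "u \<in> Cc"
  shows "finite_energy b u"
proof -
  define S where "S = {x. u x \<noteq> 0} \<union> (\<Union>y\<in>{x. u x \<noteq> 0}. E `` {y})"
  have "finite S"
    using assms locally_finite unfolding S_def Cc_def by auto
  moreover have "energy_density b u x = 0" if "x \<notin> S" for x
  proof -
    have "u x = 0" using that by (auto simp: S_def)
    moreover have "u y = 0" if "y \<in> E `` {x}" for y
    proof (rule ccontr)
      assume "u y \<noteq> 0"
      moreover have "(y, x) \<in> E" using that sym_E by (auto dest: symD)
      ultimately show False using \<open>x \<notin> S\<close> by (auto simp: S_def)
    qed
    ultimately show ?thesis by (simp add: energy_density_def Gamma_def)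
  qed
  ultimately show ?thesis
    using summable_on_cong_neutral[of UNIV S "energy_density b u" "energy_density b u"] by auto
qed

context
  fixes b :: "'v \<Rightarrow> real"
  assumes b_nonneg: "\<And>x. 0 \<le> b x"
begin

lemma energy_density_nonneg: "0 \<le> energy_density b u x"
  unfolding energy_density_def using measure_pos[of x] Gamma_nonneg[of u x] b_nonneg[of x] by simp

lemma energy_density_ge_square: "\<mu> x * b x * (u x)\<^sup>2 \<le> energy_density b u x"
  unfolding energy_density_def using measure_pos[of x] Gamma_nonneg[of u x] by (simp add: algebra_simps)

lemma energy_nonneg: "0 \<le> energy b u"
  unfolding energy_def by (rule infsum_nonneg) (rule energy_density_nonneg)

lemma finite_energy_add_diff:
  assumes "finite_energy b u" "finite_energy b v"
  shows "finite_energy b (\<lambda>x. u x + v x)" "finite_energy b (\<lambda>x. u x - v x)"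
proof -
  have s: "(\<lambda>x. 2 * energy_density b u x + 2 * energy_density b v x) summable_on UNIV"
    using assms by (intro summable_on_add summable_on_cmult_right)
  have "energy_density b (\<lambda>x. u x + v x) x \<le> 2 * energy_density b u x + 2 * energy_density b v x"
    and "energy_density b (\<lambda>x. u x - v x) x \<le> 2 * energy_density b u x + 2 * energy_density b v x" for x
    using energy_density_parallelogram[of b u v x] energy_density_nonneg[of "\<lambda>x. u x + v x" x]
      energy_density_nonneg[of "\<lambda>x. u x - v x" x] by argo+
  then show "finite_energy b (\<lambda>x. u x + v x)" "finite_energy b (\<lambda>x. u x - v x)"
    using energy_density_nonneg by (auto intro: summable_on_comparison_test[OF s])
qed

lemma energy_parallelogram:
  assumes "finite_energy b u" "finite_energy b v"
  shows "energy b (\<lambda>x. u x + v x) + energy b (\<lambda>x. u x - v x) = 2 * energy b u + 2 * energy b v"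
proof -
  have "energy b (\<lambda>x. u x + v x) + energy b (\<lambda>x. u x - v x)
    = (\<Sum>\<^sub>\<infinity>x. energy_density b (\<lambda>x. u x + v x) x + energy_density b (\<lambda>x. u x - v x) x)"
    unfolding energy_def using finite_energy_add_diff[OF assms] by (simp add: infsum_add)
  also have "\<dots> = (\<Sum>\<^sub>\<infinity>x. 2 * energy_density b u x + 2 * energy_density b v x)"
    by (simp only: energy_density_parallelogram)
  also have "\<dots> = 2 * energy b u + 2 * energy b v"
    unfolding energy_def using assms
    by (simp add: infsum_add summable_on_cmult_right infsum_cmult_right')
  finally show ?thesis .
qed

lemma energy_add_diff_le:
  assumes "finite_energy b u" "finite_energy b v"
  shows "energy b (\<lambda>x. u x + v x) \<le> 2 * energy b u + 2 * energy b v"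
    and "energy b (\<lambda>x. u x - v x) \<le> 2 * energy b u + 2 * energy b v"
  using energy_parallelogram[OF assms] energy_nonneg[of "\<lambda>x. u x + v x"]
    energy_nonneg[of "\<lambda>x. u x - v x"] by argo+

lemma energy_density_le_energy: "finite_energy b u \<Longrightarrow> energy_density b u x \<le> energy b u"
  using finite_sum_le_infsum[of "energy_density b u" UNIV "{x}"] energy_density_nonneg by (simp add: energy_def)

text \<open>
  Completeness in disguise: with \<open>m\<close> fixed, Fatou's lemma for \<open>n \<rightarrow> \<infinity>\<close> carries the Cauchy bound on
  \<open>v m - v n\<close> over to \<open>v m - l\<close>.
\<close>

lemma energy_limit:
  assumes fin: "\<And>m n::nat. finite_energy b (\<lambda>x. v m x - v n x)"
    and cauchy: "\<And>e. e > 0 \<Longrightarrow> \<exists>M. \<forall>m\<ge>M. \<forall>n\<ge>M. energy b (\<lambda>x. v m x - v n x) < e"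
    and lim: "\<And>x. (\<lambda>n. v n x) \<longlonglongrightarrow> l x" and "e > 0"
  shows "\<exists>M. \<forall>m\<ge>M. finite_energy b (\<lambda>x. v m x - l x) \<and> energy b (\<lambda>x. v m x - l x) \<le> e"
proof -
  obtain M where M: "\<And>m n. m \<ge> M \<Longrightarrow> n \<ge> M \<Longrightarrow> energy b (\<lambda>x. v m x - v n x) < e"
    using cauchy[OF \<open>e > 0\<close>] by blast
  have "finite_energy b (\<lambda>x. v m x - l x) \<and> energy b (\<lambda>x. v m x - l x) \<le> e" if "m \<ge> M" for m
  proof -
    have "\<forall>\<^sub>F n in sequentially. finite_energy b (\<lambda>x. v m x - v n x) \<and>
        infsum (energy_density b (\<lambda>x. v m x - v n x)) UNIV \<le> e"
      using eventually_ge_at_top[of M]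
      by eventually_elim (use M[OF that] fin in \<open>auto simp: energy_def intro: less_imp_le\<close>)
    moreover have "(\<lambda>n. energy_density b (\<lambda>x. v m x - v n x) x) \<longlonglongrightarrow> energy_density b (\<lambda>x. v m x - l x) x" for x
      by (intro energy_density_tendsto tendsto_intros lim)
    ultimately show ?thesis
      using infsum_fatou[of "\<lambda>n. energy_density b (\<lambda>x. v m x - v n x)" e] energy_density_nonneg
      unfolding energy_def by blast
  qed
  then show ?thesis by blast
qed

end

lemma H1_norm_eq: "H1_norm E \<omega> \<mu> u = sqrt (energy (\<lambda>_. 1) u)"
  unfolding H1_norm_def energy_def integral_V_def energy_density_def[abs_def] by simp

text \<open>
  The sequences in the definition of the completion are traded for approximation: \<open>H\<^sup>1\<close> is the closure
  of the finitely supported functions in the energy norm. Conversely, approximants with errors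
  \<open>1 / (n + 1)\<close> form a Cauchy sequence, and they converge pointwise because \<open>\<mu> x (u x)\<^sup>2\<close> is at most the
  energy of \<open>u\<close>.
\<close>

lemma H1_iff:
  "u \<in> H1 E \<omega> \<mu> \<longleftrightarrow> (\<forall>e>0. \<exists>\<phi>\<in>Cc. finite_energy (\<lambda>_. 1) (\<lambda>x. u x - \<phi> x) \<and>
     energy (\<lambda>_. 1) (\<lambda>x. u x - \<phi> x) < e)"
  (is "_ \<longleftrightarrow> ?R")
proof
  assume "u \<in> H1 E \<omega> \<mu>"
  then obtain \<phi> :: "nat \<Rightarrow> 'v \<Rightarrow> real" where \<phi>: "\<And>n. \<phi> n \<in> Cc"
    and cauchy: "\<And>e. e > 0 \<Longrightarrow> \<exists>M. \<forall>m\<ge>M. \<forall>n\<ge>M. H1_norm E \<omega> \<mu> (\<lambda>x. \<phi> m x - \<phi> n x) < e"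
    and lim: "\<And>x. (\<lambda>n. \<phi> n x) \<longlonglongrightarrow> u x"
    unfolding H1_def by blast
  show ?R
  proof (intro allI impI)
    fix e :: real assume "e > 0"
    have "\<exists>M. \<forall>m\<ge>M. \<forall>n\<ge>M. energy (\<lambda>_. 1) (\<lambda>x. \<phi> m x - \<phi> n x) < d" if "d > 0" for d
      using cauchy[of "sqrt d"] that by (simp add: H1_norm_eq)
    then obtain M where M: "finite_energy (\<lambda>_. 1) (\<lambda>x. \<phi> M x - u x)"
        "energy (\<lambda>_. 1) (\<lambda>x. \<phi> M x - u x) \<le> e/2"
      using energy_limit[of "\<lambda>_. 1" \<phi> u "e/2"] Cc_finite_energy[OF Cc_diff[OF \<phi> \<phi>]] lim \<open>e > 0\<close>
      by auto
    have "(\<lambda>x. u x - \<phi> M x) = (\<lambda>x. -1 * (\<phi> M x - u x))" by auto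
    then have "finite_energy (\<lambda>_. 1) (\<lambda>x. u x - \<phi> M x)" "energy (\<lambda>_. 1) (\<lambda>x. u x - \<phi> M x) < e"
      using finite_energy_scale[OF M(1), of "-1"] energy_scale[of "\<lambda>_. 1" "-1" "\<lambda>x. \<phi> M x - u x"]
        M(2) \<open>e > 0\<close> by auto
    then show "\<exists>\<phi>\<in>Cc. finite_energy (\<lambda>_. 1) (\<lambda>x. u x - \<phi> x) \<and> energy (\<lambda>_. 1) (\<lambda>x. u x - \<phi> x) < e"
      using \<phi> by blast
  qed
next
  assume R: ?R
  have "\<exists>\<phi>\<in>Cc. finite_energy (\<lambda>_. 1) (\<lambda>x. u x - \<phi> x) \<and>
      energy (\<lambda>_. 1) (\<lambda>x. u x - \<phi> x) < inverse (real (Suc n))" for n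
    using R by simp
  then obtain \<phi> where \<phi>: "\<And>n. \<phi> n \<in> Cc" "\<And>n. finite_energy (\<lambda>_. 1) (\<lambda>x. u x - \<phi> n x)"
    and small: "\<And>n. energy (\<lambda>_. 1) (\<lambda>x. u x - \<phi> n x) < inverse (real (Suc n))"
    by metis
  have "\<exists>M. \<forall>m\<ge>M. \<forall>n\<ge>M. H1_norm E \<omega> \<mu> (\<lambda>x. \<phi> m x - \<phi> n x) < e" if "e > 0" for e
  proof -
    have "e\<^sup>2 / 4 > 0" using that by simp
    then obtain M where M: "inverse (real (Suc M)) < e\<^sup>2 / 4"
      using reals_Archimedean by blast
    have "H1_norm E \<omega> \<mu> (\<lambda>x. \<phi> m x - \<phi> n x) < e" if "m \<ge> M" "n \<ge> M" for m n
    proof -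
      have le: "inverse (real (Suc k)) \<le> inverse (real (Suc M))" if "k \<ge> M" for k
        using that by (simp add: field_simps)
      have "energy (\<lambda>_. 1) (\<lambda>x. \<phi> m x - \<phi> n x)
          = energy (\<lambda>_. 1) (\<lambda>x. (u x - \<phi> n x) - (u x - \<phi> m x))" by simp
      also have "\<dots> \<le> 2 * energy (\<lambda>_. 1) (\<lambda>x. u x - \<phi> n x) + 2 * energy (\<lambda>_. 1) (\<lambda>x. u x - \<phi> m x)"
        using \<phi>(2) by (intro energy_add_diff_le) auto
      also have "\<dots> < e\<^sup>2"
        using small[of n] small[of m] le[OF \<open>m \<ge> M\<close>] le[OF \<open>n \<ge> M\<close>] M by argo
      finally show ?thesis
        using \<open>e > 0\<close> unfolding H1_norm_eq by (intro real_less_lsqrt) auto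
    qed
    then show ?thesis by blast
  qed
  moreover have "(\<lambda>n. \<phi> n x) \<longlonglongrightarrow> u x" for x
  proof -
    have "(\<lambda>n. (u x - \<phi> n x)\<^sup>2) \<longlonglongrightarrow> 0"
    proof (rule tendsto_sandwich[OF _ _ tendsto_const])
      have "\<mu> x * (u x - \<phi> n x)\<^sup>2 \<le> inverse (real (Suc n))" for n
        using energy_density_ge_square[of "\<lambda>_. 1" x "\<lambda>x. u x - \<phi> n x"] small[of n]
          energy_density_le_energy[OF _ \<phi>(2), of n x] by simp
      then show "\<forall>\<^sub>F n in sequentially. (u x - \<phi> n x)\<^sup>2 \<le> inverse (real (Suc n)) / \<mu> x"
        using measure_pos[of x] by (simp add: pos_le_divide_eq mult.commute)
      show "(\<lambda>n. inverse (real (Suc n)) / \<mu> x) \<longlonglongrightarrow> 0"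
        using tendsto_divide[OF LIMSEQ_inverse_real_of_nat tendsto_const, of "\<mu> x"]
          measure_pos[of x] by simp
      show "\<forall>\<^sub>F n in sequentially. 0 \<le> (u x - \<phi> n x)\<^sup>2" by simp
    qed
    then have "(\<lambda>n. u x - \<phi> n x) \<longlonglongrightarrow> 0" by simp
    then have "(\<lambda>n. u x - (u x - \<phi> n x)) \<longlonglongrightarrow> u x - 0" by (intro tendsto_intros)
    then show ?thesis by simp
  qed
  ultimately show "u \<in> H1 E \<omega> \<mu>" unfolding H1_def using \<phi>(1) by blast
qed

lemma H1_finite_energy:
  assumes "u \<in> H1 E \<omega> \<mu>"
  shows "finite_energy (\<lambda>_. 1) u"
proof -
  obtain \<phi> where \<phi>: "\<phi> \<in> Cc" "finite_energy (\<lambda>_. 1) (\<lambda>x. u x - \<phi> x)"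
    using assms[unfolded H1_iff, rule_format, of 1] by auto
  show ?thesis
    using finite_energy_add_diff(1)[OF _ \<phi>(2) Cc_finite_energy[OF \<phi>(1)]] by simp
qed

lemma H1_closed:
  assumes "\<And>e. e > 0 \<Longrightarrow> \<exists>v\<in>H1 E \<omega> \<mu>. finite_energy (\<lambda>_. 1) (\<lambda>x. u x - v x) \<and>
     energy (\<lambda>_. 1) (\<lambda>x. u x - v x) < e"
  shows "u \<in> H1 E \<omega> \<mu>"
  unfolding H1_iff
proof (intro allI impI)
  fix e :: real assume "e > 0"
  then obtain v where v: "v \<in> H1 E \<omega> \<mu>" "finite_energy (\<lambda>_. 1) (\<lambda>x. u x - v x)"
      "energy (\<lambda>_. 1) (\<lambda>x. u x - v x) < e / 4"
    using assms[of "e/4"] by auto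
  then obtain \<phi> where \<phi>: "\<phi> \<in> Cc" "finite_energy (\<lambda>_. 1) (\<lambda>x. v x - \<phi> x)"
      "energy (\<lambda>_. 1) (\<lambda>x. v x - \<phi> x) < e / 4"
    using v(1)[unfolded H1_iff, rule_format, of "e/4"] \<open>e > 0\<close> by auto
  have "finite_energy (\<lambda>_. 1) (\<lambda>x. u x - \<phi> x)" "energy (\<lambda>_. 1) (\<lambda>x. u x - \<phi> x) < e"
    using finite_energy_add_diff(1)[OF _ v(2) \<phi>(2)] energy_add_diff_le(1)[OF _ v(2) \<phi>(2)]
      v(3) \<phi>(3) by auto
  then show "\<exists>\<phi>\<in>Cc. finite_energy (\<lambda>_. 1) (\<lambda>x. u x - \<phi> x) \<and> energy (\<lambda>_. 1) (\<lambda>x. u x - \<phi> x) < e"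
    using \<phi>(1) by blast
qed

lemma H1_scale:
  assumes "u \<in> H1 E \<omega> \<mu>"
  shows "(\<lambda>x. c * u x) \<in> H1 E \<omega> \<mu>"
  unfolding H1_iff
proof (intro allI impI)
  fix e :: real assume "e > 0"
  then have pos: "e / (c\<^sup>2 + 1) > 0" by (simp add: add_nonneg_pos)
  then obtain \<phi> where \<phi>: "\<phi> \<in> Cc" "finite_energy (\<lambda>_. 1) (\<lambda>x. u x - \<phi> x)"
      "energy (\<lambda>_. 1) (\<lambda>x. u x - \<phi> x) < e / (c\<^sup>2 + 1)"
    using assms[unfolded H1_iff, rule_format, OF pos] by auto
  have eq: "(\<lambda>x. c * u x - c * \<phi> x) = (\<lambda>x. c * (u x - \<phi> x))" by (simp add: algebra_simps)
  have "energy (\<lambda>_. 1) (\<lambda>x. c * u x - c * \<phi> x) = c\<^sup>2 * energy (\<lambda>_. 1) (\<lambda>x. u x - \<phi> x)"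
    unfolding eq by (rule energy_scale)
  also have "\<dots> \<le> c\<^sup>2 * (e / (c\<^sup>2 + 1))"
    using \<phi>(3) by (intro mult_left_mono) auto
  also have "\<dots> < e"
    using \<open>e > 0\<close> add_nonneg_pos[of "c\<^sup>2" 1] by (simp add: pos_divide_less_eq algebra_simps)
  finally show "\<exists>\<phi>\<in>Cc. finite_energy (\<lambda>_. 1) (\<lambda>x. c * u x - \<phi> x) \<and>
      energy (\<lambda>_. 1) (\<lambda>x. c * u x - \<phi> x) < e"
    using finite_energy_scale[OF \<phi>(2), of c] Cc_scale[OF \<phi>(1), of c] unfolding eq[symmetric]
    by (intro bexI[of _ "\<lambda>x. c * \<phi> x"]) auto
qed

lemma H1_add:
  assumes "u \<in> H1 E \<omega> \<mu>" "v \<in> H1 E \<omega> \<mu>"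
  shows "(\<lambda>x. u x + v x) \<in> H1 E \<omega> \<mu>"
  unfolding H1_iff
proof (intro allI impI)
  fix e :: real assume "e > 0"
  obtain \<phi> where \<phi>: "\<phi> \<in> Cc" "finite_energy (\<lambda>_. 1) (\<lambda>x. u x - \<phi> x)"
      "energy (\<lambda>_. 1) (\<lambda>x. u x - \<phi> x) < e / 4"
    using assms(1)[unfolded H1_iff, rule_format, of "e/4"] \<open>e > 0\<close> by auto
  obtain \<psi> where \<psi>: "\<psi> \<in> Cc" "finite_energy (\<lambda>_. 1) (\<lambda>x. v x - \<psi> x)"
      "energy (\<lambda>_. 1) (\<lambda>x. v x - \<psi> x) < e / 4"
    using assms(2)[unfolded H1_iff, rule_format, of "e/4"] \<open>e > 0\<close> by auto
  have eq: "(\<lambda>x. u x + v x - (\<phi> x + \<psi> x)) = (\<lambda>x. (u x - \<phi> x) + (v x - \<psi> x))" by auto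
  have "finite_energy (\<lambda>_. 1) (\<lambda>x. u x + v x - (\<phi> x + \<psi> x))"
      "energy (\<lambda>_. 1) (\<lambda>x. u x + v x - (\<phi> x + \<psi> x)) < e"
    unfolding eq
    using finite_energy_add_diff(1)[OF _ \<phi>(2) \<psi>(2)] energy_add_diff_le(1)[OF _ \<phi>(2) \<psi>(2)]
      \<phi>(3) \<psi>(3) by auto
  then show "\<exists>\<phi>\<in>Cc. finite_energy (\<lambda>_. 1) (\<lambda>x. u x + v x - \<phi> x) \<and>
      energy (\<lambda>_. 1) (\<lambda>x. u x + v x - \<phi> x) < e"
    using Cc_add[OF \<phi>(1) \<psi>(1)] by (intro bexI[of _ "\<lambda>x. \<phi> x + \<psi> x"]) auto
qed

end

section \<open>The Hilbert space of a potential bounded below\<close>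

locale weighted_graph_potential = weighted_graph E \<omega> \<mu>
  for E :: "('v \<times> 'v) set" and \<omega> :: "'v \<Rightarrow> 'v \<Rightarrow> real" and \<mu> :: "'v \<Rightarrow> real" +
  fixes a :: "'v \<Rightarrow> real" and a0 :: real
  assumes a0_gt: "-1 < a0" and a0_neg: "a0 < 0" and a_ge: "a0 \<le> a x"
begin

abbreviation \<H> :: "('v \<Rightarrow> real) set" where "\<H> \<equiv> H_space E \<omega> \<mu> a"
abbreviation \<H>_norm :: "('v \<Rightarrow> real) \<Rightarrow> real" where "\<H>_norm \<equiv> H_norm E \<omega> \<mu> a"

text \<open>
  The coefficient of \<open>u\<^sup>2\<close> in the norm of \<open>\<H>\<close>.
\<close>

definition b :: "'v \<Rightarrow> real" where "b x = a x + 1"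

lemma b_pos: "0 < b x"
  using a_ge[of x] a0_gt unfolding b_def by linarith

lemma b_nonneg: "0 \<le> b x"
  using b_pos[of x] by simp

lemma H_norm_eq: "\<H>_norm u = sqrt (energy b u)"
  unfolding H_norm_def H_inner_def integral_V_def energy_def energy_density_def[abs_def] b_def
  by (simp add: power2_eq_square mult.assoc)

text \<open>
  Since \<open>0 < a0 + 1 \<le> 1\<close>, the factor \<open>a0 + 1\<close> can be spent on both terms of the density, so the norm
  of \<open>\<H>\<close> dominates that of \<open>H\<^sup>1\<close>.
\<close>

lemma energy_density_one_le: "energy_density (\<lambda>_. 1) u x \<le> energy_density b u x / (a0 + 1)"
proof -
  have "(a0 + 1) * (Gamma E \<omega> \<mu> u u x + (u x)\<^sup>2) \<le> Gamma E \<omega> \<mu> u u x + b x * (u x)\<^sup>2"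
  proof -
    have "(a0 + 1) * Gamma E \<omega> \<mu> u u x \<le> 1 * Gamma E \<omega> \<mu> u u x"
      using a0_neg by (intro mult_right_mono Gamma_nonneg) auto
    moreover have "(a0 + 1) * (u x)\<^sup>2 \<le> b x * (u x)\<^sup>2"
      using a_ge[of x] by (intro mult_right_mono) (auto simp: b_def)
    ultimately show ?thesis by (simp add: algebra_simps)
  qed
  from mult_left_mono[OF this, of "\<mu> x"]
  have "(a0 + 1) * energy_density (\<lambda>_. 1) u x \<le> energy_density b u x"
    using measure_pos[of x] unfolding energy_density_def by (simp add: mult.left_commute)
  then show ?thesis using a0_gt by (simp add: pos_le_divide_eq mult.commute)
qed

lemma energy_one_le:
  assumes "finite_energy b u"
  shows "finite_energy (\<lambda>_. 1) u" "energy (\<lambda>_. 1) u \<le> energy b u / (a0 + 1)"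
proof -
  have s: "(\<lambda>x. inverse (a0 + 1) * energy_density b u x) summable_on UNIV"
    using assms by (rule summable_on_cmult_right)
  have le: "energy_density (\<lambda>_. 1) u x \<le> inverse (a0 + 1) * energy_density b u x" for x
    using energy_density_one_le[of u x] by (simp add: field_simps)
  show fin: "finite_energy (\<lambda>_. 1) u"
    using le energy_density_nonneg[of "\<lambda>_. 1"] by (auto intro: summable_on_comparison_test[OF s])
  have "energy (\<lambda>_. 1) u \<le> (\<Sum>\<^sub>\<infinity>x. inverse (a0 + 1) * energy_density b u x)"
    unfolding energy_def using le by (intro infsum_mono fin s) auto
  also have "\<dots> = energy b u / (a0 + 1)"
    unfolding energy_def infsum_cmult_right' by (simp add: field_simps)
  finally show "energy (\<lambda>_. 1) u \<le> energy b u / (a0 + 1)" .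
qed

text \<open>
  On \<open>H\<^sup>1\<close> the densities for \<open>a + 1\<close> and for \<open>1\<close> differ exactly by \<open>\<mu> a u\<^sup>2\<close>, and the second is
  summable.
\<close>

lemma H_space_iff: "u \<in> \<H> \<longleftrightarrow> u \<in> H1 E \<omega> \<mu> \<and> finite_energy b u"
proof -
  have "integrable_V \<mu> UNIV (\<lambda>x. a x * (u x)\<^sup>2) \<longleftrightarrow> finite_energy b u" if "u \<in> H1 E \<omega> \<mu>"
  proof -
    have "energy_density b u x = energy_density (\<lambda>_. 1) u x + \<mu> x * (a x * (u x)\<^sup>2)" for x
      by (simp add: energy_density_def b_def algebra_simps)
    then have eq: "energy_density b u = (\<lambda>x. energy_density (\<lambda>_. 1) u x + \<mu> x * (a x * (u x)\<^sup>2))" ..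
    show ?thesis
    proof
      assume "integrable_V \<mu> UNIV (\<lambda>x. a x * (u x)\<^sup>2)"
      then show "finite_energy b u"
        unfolding eq integrable_V_def using H1_finite_energy[OF that] by (intro summable_on_add)
    next
      assume "finite_energy b u"
      then have "(\<lambda>x. energy_density b u x + -1 * energy_density (\<lambda>_. 1) u x) summable_on UNIV"
        using H1_finite_energy[OF that] by (intro summable_on_add summable_on_cmult_right)
      then show "integrable_V \<mu> UNIV (\<lambda>x. a x * (u x)\<^sup>2)"
        unfolding eq integrable_V_def by simp
    qed
  qed
  then show ?thesis unfolding H_space_def by auto
qed

text \<open>
  The pointwise limit is approximated in the energy for \<open>a + 1\<close>, hence also in that of \<open>H\<^sup>1\<close>, in which
  \<open>H\<^sup>1\<close> is closed.
\<close>

lemma H_space_complete: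
  assumes v: "\<And>n::nat. v n \<in> \<H>"
    and cauchy: "\<And>e. e > 0 \<Longrightarrow> \<exists>M. \<forall>m\<ge>M. \<forall>n\<ge>M. \<H>_norm (\<lambda>x. v m x - v n x) < e"
    and lim: "\<And>x. (\<lambda>n. v n x) \<longlonglongrightarrow> l x"
  shows "l \<in> \<H> \<and> (\<lambda>n. \<H>_norm (\<lambda>x. v n x - l x)) \<longlonglongrightarrow> 0"
proof -
  have v_fin: "finite_energy b (v n)" and v_H1: "v n \<in> H1 E \<omega> \<mu>" for n
    using v[of n] by (auto simp: H_space_iff)
  have near: "\<exists>M. \<forall>m\<ge>M. finite_energy b (\<lambda>x. v m x - l x) \<and> energy b (\<lambda>x. v m x - l x) \<le> e"
    if "e > 0" for e
  proof (rule energy_limit[of b v l, OF b_nonneg _ _ lim that])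
    show "finite_energy b (\<lambda>x. v m x - v n x)" for m n
      by (intro finite_energy_add_diff(2)[of b, OF b_nonneg] v_fin)
    show "\<exists>M. \<forall>m\<ge>M. \<forall>n\<ge>M. energy b (\<lambda>x. v m x - v n x) < d" if "d > 0" for d
      using cauchy[of "sqrt d"] that by (simp add: H_norm_eq)
  qed
  have near': "\<exists>m. finite_energy b (\<lambda>x. l x - v m x) \<and> energy b (\<lambda>x. l x - v m x) \<le> e"
    if "e > 0" for e
  proof -
    obtain m where m: "finite_energy b (\<lambda>x. v m x - l x)" "energy b (\<lambda>x. v m x - l x) \<le> e"
      using near[OF \<open>e > 0\<close>] by blast
    have "(\<lambda>x. l x - v m x) = (\<lambda>x. -1 * (v m x - l x))" by auto
    then show ?thesis
      using finite_energy_scale[OF m(1), of "-1"] energy_scale[of b "-1" "\<lambda>x. v m x - l x"] m(2)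
      by (intro exI[of _ m]) simp
  qed
  have "l \<in> H1 E \<omega> \<mu>"
  proof (rule H1_closed)
    fix e :: real assume "e > 0"
    define d where "d = e / 2 * (a0 + 1)"
    have "d / (a0 + 1) = e / 2" using a0_gt unfolding d_def by (intro nonzero_mult_div_cancel_right) simp
    then have d: "d / (a0 + 1) < e" using \<open>e > 0\<close> by linarith
    have "d > 0" using \<open>e > 0\<close> a0_gt by (simp add: d_def)
    obtain m where m: "finite_energy b (\<lambda>x. l x - v m x)" "energy b (\<lambda>x. l x - v m x) \<le> d"
      using near'[OF \<open>d > 0\<close>] by blast
    have "energy b (\<lambda>x. l x - v m x) / (a0 + 1) \<le> d / (a0 + 1)"
      using m(2) a0_gt by (intro divide_right_mono) auto
    then have "finite_energy (\<lambda>_. 1) (\<lambda>x. l x - v m x) \<and> energy (\<lambda>_. 1) (\<lambda>x. l x - v m x) < e"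
      using energy_one_le[OF m(1)] d by auto
    then show "\<exists>v\<in>H1 E \<omega> \<mu>. finite_energy (\<lambda>_. 1) (\<lambda>x. l x - v x) \<and>
        energy (\<lambda>_. 1) (\<lambda>x. l x - v x) < e"
      using v_H1 by blast
  qed
  moreover have "finite_energy b l"
  proof -
    obtain m where "finite_energy b (\<lambda>x. l x - v m x)"
      using near'[of 1] by auto
    from finite_energy_add_diff(1)[of b, OF b_nonneg this v_fin[of m]] show ?thesis by simp
  qed
  moreover have "(\<lambda>n. energy b (\<lambda>x. v n x - l x)) \<longlonglongrightarrow> 0"
  proof (rule LIMSEQ_I)
    fix r :: real assume "r > 0"
    then obtain M where "\<And>m. m \<ge> M \<Longrightarrow> energy b (\<lambda>x. v m x - l x) \<le> r/2"
      using near[of "r/2"] by auto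
    then show "\<exists>M. \<forall>n\<ge>M. norm (energy b (\<lambda>x. v n x - l x) - 0) < r"
      using energy_nonneg[of b, OF b_nonneg] \<open>r > 0\<close> by (intro exI[of _ M]) fastforce
  qed
  ultimately show ?thesis
    unfolding H_space_iff H_norm_eq using tendsto_real_sqrt by force
qed

sublocale \<H>: hilbert_function_space \<H> \<H>_norm
proof
  show "\<H>_norm (\<lambda>x. c * u x) = \<bar>c\<bar> * \<H>_norm u" for c u
    by (simp add: H_norm_eq energy_scale real_sqrt_mult)
  show "(\<H>_norm (\<lambda>x. u x + v x))\<^sup>2 + (\<H>_norm (\<lambda>x. u x - v x))\<^sup>2
      = 2 * (\<H>_norm u)\<^sup>2 + 2 * (\<H>_norm v)\<^sup>2" if "u \<in> \<H>" "v \<in> \<H>" for u v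
    using that energy_parallelogram[of b, OF b_nonneg] energy_nonneg[of b, OF b_nonneg]
    by (simp add: H_space_iff H_norm_eq)
  show "(\<lambda>x. u x + v x) \<in> \<H>" if "u \<in> \<H>" "v \<in> \<H>" for u v
    using that finite_energy_add_diff(1)[of b, OF b_nonneg] by (simp add: H_space_iff H1_add)
  show "(\<lambda>x. c * u x) \<in> \<H>" if "u \<in> \<H>" for u c
    using that by (simp add: H_space_iff H1_scale finite_energy_scale)
  show "0 \<le> \<H>_norm u" for u
    using energy_nonneg[of b, OF b_nonneg] by (simp add: H_norm_eq)
qed (rule H_space_complete)

text \<open>
  Cauchy-Schwarz for the splitting \<open>\<mu> \<bar>u\<bar> = \<surd>(\<mu> / (a + 1)) \<cdot> \<surd>(\<mu> (a + 1)) \<bar>u\<bar>\<close>.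
\<close>

lemma sum_le_H_norm:
  assumes "u \<in> \<H>" "finite F"
  shows "(\<Sum>x\<in>F. \<mu> x * \<bar>u x\<bar>) \<le> sqrt (\<Sum>x\<in>F. \<mu> x / (a x + 1)) * \<H>_norm u"
proof -
  have b: "0 < a x + 1" for x using b_pos by (simp add: b_def)
  have "\<mu> x * \<bar>u x\<bar> = sqrt (\<mu> x / (a x + 1)) * (sqrt (\<mu> x * (a x + 1)) * \<bar>u x\<bar>)" for x
  proof -
    have "sqrt (\<mu> x / (a x + 1)) * sqrt (\<mu> x * (a x + 1)) = sqrt (\<mu> x * \<mu> x)"
      using b[of x] unfolding real_sqrt_mult[symmetric] by simp
    then show ?thesis using measure_pos[of x] by (simp add: mult.assoc[symmetric])
  qed
  then have "(\<Sum>x\<in>F. \<mu> x * \<bar>u x\<bar>)\<^sup>2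
      = (\<Sum>x\<in>F. sqrt (\<mu> x / (a x + 1)) * (sqrt (\<mu> x * (a x + 1)) * \<bar>u x\<bar>))\<^sup>2"
    by (simp only:)
  also have "\<dots> \<le> (\<Sum>x\<in>F. (sqrt (\<mu> x / (a x + 1)))\<^sup>2)
      * (\<Sum>x\<in>F. (sqrt (\<mu> x * (a x + 1)) * \<bar>u x\<bar>)\<^sup>2)"
    by (rule Cauchy_Schwarz_ineq_sum)
  also have "\<dots> = (\<Sum>x\<in>F. \<mu> x / (a x + 1)) * (\<Sum>x\<in>F. \<mu> x * b x * (u x)\<^sup>2)"
    using b measure_pos by (simp add: power_mult_distrib b_def less_imp_le)
  also have "\<dots> \<le> (\<Sum>x\<in>F. \<mu> x / (a x + 1)) * energy b u"
  proof (rule mult_left_mono)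
    have "(\<Sum>x\<in>F. \<mu> x * b x * (u x)\<^sup>2) \<le> sum (energy_density b u) F"
      by (intro sum_mono energy_density_ge_square b_nonneg)
    also have "\<dots> \<le> energy b u"
      unfolding energy_def using assms energy_density_nonneg[of b, OF b_nonneg]
      by (intro finite_sum_le_infsum) (auto simp: H_space_iff)
    finally show "(\<Sum>x\<in>F. \<mu> x * b x * (u x)\<^sup>2) \<le> energy b u" .
    show "0 \<le> (\<Sum>x\<in>F. \<mu> x / (a x + 1))"
      using b measure_pos by (intro sum_nonneg) (simp add: less_imp_le)
  qed
  finally show ?thesis
    unfolding H_norm_eq real_sqrt_mult[symmetric] by (rule real_le_rsqrt)
qed

lemma L1_le_H_norm:
  assumes k: "(\<lambda>x. \<mu> x / (a x + 1)) summable_on UNIV" and u: "u \<in> \<H>"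
  shows "(\<lambda>x. \<mu> x * \<bar>u x\<bar>) summable_on A"
    and "(\<Sum>\<^sub>\<infinity>x\<in>A. \<mu> x * \<bar>u x\<bar>) \<le> sqrt (\<Sum>\<^sub>\<infinity>x\<in>A. \<mu> x / (a x + 1)) * \<H>_norm u"
proof -
  have k_nonneg: "0 \<le> \<mu> x / (a x + 1)" for x
    using b_pos[of x] measure_pos[of x] by (simp add: b_def less_imp_le)
  have kA: "(\<lambda>x. \<mu> x / (a x + 1)) summable_on A"
    using k by (rule summable_on_subset_banach) simp
  have "(\<Sum>x\<in>F. \<mu> x * \<bar>u x\<bar>) \<le> sqrt (\<Sum>\<^sub>\<infinity>x\<in>A. \<mu> x / (a x + 1)) * \<H>_norm u"
    if "finite F" "F \<subseteq> A" for F
  proof -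
    note sum_le_H_norm[OF u \<open>finite F\<close>]
    also have "sqrt (\<Sum>x\<in>F. \<mu> x / (a x + 1)) * \<H>_norm u
        \<le> sqrt (\<Sum>\<^sub>\<infinity>x\<in>A. \<mu> x / (a x + 1)) * \<H>_norm u"
      using that k_nonneg \<H>.norm_nonneg[OF u]
      by (intro mult_right_mono real_sqrt_le_mono finite_sum_le_infsum kA) auto
    finally show ?thesis .
  qed
  then show "(\<lambda>x. \<mu> x * \<bar>u x\<bar>) summable_on A"
    and "(\<Sum>\<^sub>\<infinity>x\<in>A. \<mu> x * \<bar>u x\<bar>) \<le> sqrt (\<Sum>\<^sub>\<infinity>x\<in>A. \<mu> x / (a x + 1)) * \<H>_norm u"
    using measure_pos by (auto intro!: summable_on_bounded_sums simp: less_imp_le)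
qed

text \<open>
  Outside a finite set the \<open>L\<^sup>1\<close> mass is small uniformly in \<open>n\<close>, and on the finite set pointwise
  convergence suffices.
\<close>

lemma pointwise_null_imp_L1_null:
  assumes k: "(\<lambda>x. \<mu> x / (a x + 1)) summable_on UNIV"
    and w: "\<And>n::nat. w n \<in> \<H>" and bound: "\<And>n. \<H>_norm (w n) \<le> C"
    and lim: "\<And>x. (\<lambda>n. w n x) \<longlonglongrightarrow> 0"
  shows "(\<lambda>n. \<Sum>\<^sub>\<infinity>x. \<mu> x * \<bar>w n x\<bar>) \<longlonglongrightarrow> 0"
proof (rule LIMSEQ_I)
  fix r :: real assume "r > 0"
  have "C \<ge> 0" by (rule order_trans[OF \<H>.norm_nonneg[OF w[of 0]] bound])
  \<comment> \<open>Chosen so that \<open>\<surd>\<delta> (C + 1) = r / 2\<close>; the summand 1 covers the case \<open>C = 0\<close>.\<close>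
  define \<rho> where "\<rho> = r / 2 / (C + 1)"
  define \<delta> where "\<delta> = \<rho>\<^sup>2"
  have "\<rho> > 0" using \<open>r > 0\<close> \<open>C \<ge> 0\<close> by (simp add: \<rho>_def)
  then have "\<delta> > 0" by (simp add: \<delta>_def)
  obtain F where F: "finite F"
    and "dist (\<Sum>x\<in>F. \<mu> x / (a x + 1)) (\<Sum>\<^sub>\<infinity>x. \<mu> x / (a x + 1)) \<le> \<delta>"
    using infsum_finite_approximation[OF k \<open>\<delta> > 0\<close>] by blast
  moreover have "(\<Sum>\<^sub>\<infinity>x\<in>UNIV - F. \<mu> x / (a x + 1))
      = (\<Sum>\<^sub>\<infinity>x. \<mu> x / (a x + 1)) - (\<Sum>x\<in>F. \<mu> x / (a x + 1))"
    using infsum_Diff[OF k, of F] F by simp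
  ultimately have tail: "(\<Sum>\<^sub>\<infinity>x\<in>UNIV - F. \<mu> x / (a x + 1)) \<le> \<delta>"
    by (simp add: dist_real_def abs_le_iff)
  have tail_w: "(\<Sum>\<^sub>\<infinity>x\<in>UNIV - F. \<mu> x * \<bar>w n x\<bar>) \<le> r / 2" for n
  proof -
    note L1_le_H_norm(2)[OF k w[of n], of "UNIV - F"]
    also have "sqrt (\<Sum>\<^sub>\<infinity>x\<in>UNIV - F. \<mu> x / (a x + 1)) * \<H>_norm (w n) \<le> sqrt \<delta> * (C + 1)"
      using tail bound[of n] \<H>.norm_nonneg[OF w] \<open>\<delta> > 0\<close>
      by (intro mult_mono real_sqrt_le_mono) auto
    also have "\<dots> = r / 2"
    proof -
      have "sqrt \<delta> = \<rho>" using \<open>\<rho> > 0\<close> by (simp add: \<delta>_def)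
      moreover have "C + 1 \<noteq> 0" using \<open>C \<ge> 0\<close> by simp
      ultimately show ?thesis unfolding \<rho>_def by (metis nonzero_eq_divide_eq)
    qed
    finally show ?thesis .
  qed
  have "(\<lambda>n. \<Sum>x\<in>F. \<mu> x * \<bar>w n x\<bar>) \<longlonglongrightarrow> (\<Sum>x\<in>F. \<mu> x * \<bar>0\<bar>)"
    by (intro tendsto_intros lim)
  then have "(\<lambda>n. \<Sum>x\<in>F. \<mu> x * \<bar>w n x\<bar>) \<longlonglongrightarrow> 0" by simp
  from LIMSEQ_D[OF this, of "r/2"] obtain M where M: "\<And>n. n \<ge> M \<Longrightarrow> \<bar>\<Sum>x\<in>F. \<mu> x * \<bar>w n x\<bar>\<bar> < r / 2"
    using \<open>r > 0\<close> by auto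
  have "norm ((\<Sum>\<^sub>\<infinity>x. \<mu> x * \<bar>w n x\<bar>) - 0) < r" if "n \<ge> M" for n
  proof -
    have "(\<Sum>\<^sub>\<infinity>x\<in>UNIV - F. \<mu> x * \<bar>w n x\<bar>)
        = (\<Sum>\<^sub>\<infinity>x. \<mu> x * \<bar>w n x\<bar>) - (\<Sum>x\<in>F. \<mu> x * \<bar>w n x\<bar>)"
      using infsum_Diff[OF L1_le_H_norm(1)[OF k w[of n], of UNIV], of F] F by simp
    moreover have "0 \<le> (\<Sum>\<^sub>\<infinity>x. \<mu> x * \<bar>w n x\<bar>)"
      using measure_pos by (intro infsum_nonneg) (simp add: less_imp_le)
    ultimately show ?thesis
      using tail_w[of n] M[OF that] by (simp add: abs_less_iff)
  qed
  then show "\<exists>M. \<forall>n\<ge>M. norm ((\<Sum>\<^sub>\<infinity>x. \<mu> x * \<bar>w n x\<bar>) - 0) < r" by blast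
qed

end

section \<open>\<open>L\<^sup>1\<close> functions on a space with atoms bounded below\<close>

text \<open>
  Atoms of mass at least \<open>m\<close> give \<open>\<bar>u x\<bar> \<le> \<parallel>u\<parallel>\<^sub>1 / m\<close>. This is the case \<open>p = \<infinity>\<close>; for finite \<open>p\<close>, it
  bounds the factor \<open>\<bar>u\<bar>\<^bsup>p-1\<^esup>\<close> of \<open>\<bar>u\<bar>\<^sup>p\<close>, so that \<open>\<parallel>u\<parallel>\<^sub>p \<le> m\<^bsup>(1-p)/p\<^esup> \<parallel>u\<parallel>\<^sub>1\<close>. The lower bound \<open>0\<close> on
  the norm is included for squeezing it to \<open>0\<close>.
\<close>

lemma L1_imp_Lp:
  fixes \<mu> :: "'v \<Rightarrow> real" and p :: ereal
  assumes "0 < m" "\<And>x. m \<le> \<mu> x" "1 \<le> p"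
  shows "\<exists>K. \<forall>u. (\<lambda>x. \<mu> x * \<bar>u x\<bar>) summable_on UNIV \<longrightarrow>
    u \<in> Lp_space \<mu> UNIV p \<and> 0 \<le> Lp_norm \<mu> UNIV p u \<and>
    Lp_norm \<mu> UNIV p u \<le> K * (\<Sum>\<^sub>\<infinity>x. \<mu> x * \<bar>u x\<bar>)"
proof -
  have mu: "0 < \<mu> x" for x using assms(1) assms(2)[of x] by linarith
  have sup: "\<bar>u x\<bar> \<le> (\<Sum>\<^sub>\<infinity>x. \<mu> x * \<bar>u x\<bar>) / m"
    if "(\<lambda>x. \<mu> x * \<bar>u x\<bar>) summable_on UNIV" for u x
  proof -
    have "m * \<bar>u x\<bar> \<le> \<mu> x * \<bar>u x\<bar>" using assms(2) by (intro mult_right_mono) auto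
    also have "\<dots> \<le> (\<Sum>\<^sub>\<infinity>x. \<mu> x * \<bar>u x\<bar>)"
      using finite_sum_le_infsum[OF that, of "{x}"] mu by (simp add: less_imp_le)
    finally show ?thesis using \<open>0 < m\<close> by (simp add: pos_le_divide_eq mult.commute)
  qed
  show ?thesis
  proof (cases "p = \<infinity>")
    case True
    have "u \<in> Lp_space \<mu> UNIV p \<and> 0 \<le> Lp_norm \<mu> UNIV p u \<and>
        Lp_norm \<mu> UNIV p u \<le> (1 / m) * (\<Sum>\<^sub>\<infinity>x. \<mu> x * \<bar>u x\<bar>)"
      if u: "(\<lambda>x. \<mu> x * \<bar>u x\<bar>) summable_on UNIV" for u
    proof -
      have bdd: "bdd_above (range (\<lambda>x. \<bar>u x\<bar>))"
        using sup[OF u] by (intro bdd_aboveI2)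
      have "0 \<le> \<bar>u undefined\<bar>" by simp
      also have "\<dots> \<le> (SUP x. \<bar>u x\<bar>)" using bdd by (intro cSUP_upper) auto
      finally have "0 \<le> (SUP x. \<bar>u x\<bar>)" .
      moreover have "(SUP x. \<bar>u x\<bar>) \<le> (\<Sum>\<^sub>\<infinity>x. \<mu> x * \<bar>u x\<bar>) / m"
        using sup[OF u] by (intro cSUP_least) auto
      ultimately show ?thesis
        using True bdd by (simp add: Lp_space_def Lp_norm_def)
    qed
    then show ?thesis by blast
  next
    case False
    then obtain q where q: "p = ereal q" "1 \<le> q" using assms(3) by (cases p) auto
    define K where "K = ((1 / m) powr (q - 1)) powr (1 / q)"
    have "u \<in> Lp_space \<mu> UNIV p \<and> 0 \<le> Lp_norm \<mu> UNIV p u \<and>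
        Lp_norm \<mu> UNIV p u \<le> K * (\<Sum>\<^sub>\<infinity>x. \<mu> x * \<bar>u x\<bar>)"
      if u: "(\<lambda>x. \<mu> x * \<bar>u x\<bar>) summable_on UNIV" for u
    proof -
      define S where "S = (\<Sum>\<^sub>\<infinity>x. \<mu> x * \<bar>u x\<bar>)"
      have "0 \<le> S"
        unfolding S_def using mu by (intro infsum_nonneg) (simp add: less_imp_le)
      have le: "\<mu> x * \<bar>u x\<bar> powr q \<le> (S / m) powr (q - 1) * (\<mu> x * \<bar>u x\<bar>)" for x
      proof -
        have "\<bar>u x\<bar> powr q = \<bar>u x\<bar> powr (q - 1) * \<bar>u x\<bar>"
          using powr_mult_base[of "\<bar>u x\<bar>" "q - 1"] by (simp add: mult.commute)
        also have "\<dots> \<le> (S / m) powr (q - 1) * \<bar>u x\<bar>"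
          using sup[OF u, of x] q(2) unfolding S_def[symmetric]
          by (intro mult_right_mono powr_mono2) auto
        finally have "\<mu> x * \<bar>u x\<bar> powr q \<le> \<mu> x * ((S / m) powr (q - 1) * \<bar>u x\<bar>)"
          using mu[of x] by (intro mult_left_mono) auto
        then show ?thesis by (simp add: mult.left_commute)
      qed
      have s: "(\<lambda>x. (S / m) powr (q - 1) * (\<mu> x * \<bar>u x\<bar>)) summable_on UNIV"
        using u by (rule summable_on_cmult_right)
      have nonneg: "0 \<le> \<mu> x * \<bar>u x\<bar> powr q" for x using mu[of x] by simp
      have int: "(\<lambda>x. \<mu> x * \<bar>u x\<bar> powr q) summable_on UNIV"
        using le nonneg by (intro summable_on_comparison_test[OF s])
      have "(\<Sum>\<^sub>\<infinity>x. \<mu> x * \<bar>u x\<bar> powr q) \<le> (\<Sum>\<^sub>\<infinity>x. (S / m) powr (q - 1) * (\<mu> x * \<bar>u x\<bar>))"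
        using le by (intro infsum_mono int s)
      also have "\<dots> = (S / m) powr (q - 1) * S"
        unfolding S_def by (rule infsum_cmult_right')
      also have "\<dots> = (1 / m) powr (q - 1) * S powr q"
        using powr_mult_base[OF \<open>0 \<le> S\<close>, of "q - 1"] powr_mult[of "1/m" S "q - 1"] \<open>0 \<le> S\<close> \<open>0 < m\<close>
        by (simp add: mult.assoc mult.commute)
      finally have "(\<Sum>\<^sub>\<infinity>x. \<mu> x * \<bar>u x\<bar> powr q) powr (1 / q)
          \<le> ((1 / m) powr (q - 1) * S powr q) powr (1 / q)"
        using q(2) nonneg by (intro powr_mono2 infsum_nonneg) auto
      also have "\<dots> = K * S"
        using \<open>0 \<le> S\<close> \<open>0 < m\<close> q(2) unfolding K_def by (simp add: powr_mult powr_powr)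
      finally show ?thesis
        using q(1) int by (simp add: Lp_space_def Lp_norm_def integrable_V_def integral_V_def S_def)
    qed
    then show ?thesis by blast
  qed
qed

section \<open>Weak precompactness and compact embeddings\<close>

context weighted_graph_potential
begin

text \<open>
  The weight \<open>\<mu> / (a + 1)\<close> is positive and summable, so there are only countably many vertices; and the
  \<open>L\<^sup>1\<close> bound makes the sequence uniformly bounded, so that the diagonal argument applies.
\<close>

lemma bounded_seq_pointwise_subseq:
  assumes k: "(\<lambda>x. \<mu> x / (a x + 1)) summable_on UNIV"
    and m: "0 < m" "\<And>x. m \<le> \<mu> x"
    and u: "\<And>n::nat. u n \<in> \<H>" and bound: "\<And>n. \<H>_norm (u n) \<le> C"
  shows "\<exists>r l. strict_mono (r :: nat \<Rightarrow> nat) \<and> (\<forall>x. (\<lambda>n. u (r n) x) \<longlonglongrightarrow> l x)"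
proof -
  have "{x \<in> UNIV. \<mu> x / (a x + 1) \<noteq> 0} = UNIV"
    using measure_pos b_pos by (auto simp: b_def less_imp_neq[symmetric])
  then have "countable (UNIV :: 'v set)"
    using summable_countable_real[OF k] by simp
  moreover have "norm (u n x) \<le> sqrt (\<Sum>\<^sub>\<infinity>x. \<mu> x / (a x + 1)) * C / m" for n x
  proof -
    have "m * \<bar>u n x\<bar> \<le> \<mu> x * \<bar>u n x\<bar>" using m(2) by (intro mult_right_mono) auto
    also have "\<dots> \<le> (\<Sum>\<^sub>\<infinity>x. \<mu> x * \<bar>u n x\<bar>)"
      using finite_sum_le_infsum[OF L1_le_H_norm(1)[OF k u], of "{x}" UNIV n] measure_pos
      by (simp add: less_imp_le)
    also have "\<dots> \<le> sqrt (\<Sum>\<^sub>\<infinity>x. \<mu> x / (a x + 1)) * \<H>_norm (u n)"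
      by (rule L1_le_H_norm(2)[OF k u])
    also have "\<dots> \<le> sqrt (\<Sum>\<^sub>\<infinity>x. \<mu> x / (a x + 1)) * C"
      using measure_pos b_pos
      by (intro mult_left_mono bound real_sqrt_ge_zero infsum_nonneg) (simp add: b_def less_imp_le)
    finally show ?thesis using m(1) by (simp add: pos_le_divide_eq mult.commute)
  qed
  ultimately obtain r :: "nat \<Rightarrow> nat" where "strict_mono r"
      "\<And>x. x \<in> UNIV \<Longrightarrow> \<exists>l. (\<lambda>n. u (r n) x) \<longlonglongrightarrow> l"
    using function_convergent_subsequence[of UNIV u] by metis
  then show ?thesis by (metis UNIV_I)
qed

theorem weakly_precompact_H_space:
  assumes "(\<lambda>x. \<mu> x / (a x + 1)) summable_on UNIV" "0 < m" "\<And>x. m \<le> \<mu> x"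
  shows "weakly_precompact \<H> \<H>_norm"
  unfolding weakly_precompact_def
proof (intro allI impI)
  fix u assume "bounded_seq_in \<H> \<H>_norm u"
  then obtain C where u: "\<And>n. u n \<in> \<H>" "\<And>n. \<H>_norm (u n) \<le> C"
    unfolding bounded_seq_in_def by blast
  obtain r l where r: "strict_mono (r :: nat \<Rightarrow> nat)" "\<And>x. (\<lambda>n. (u \<circ> r) n x) \<longlonglongrightarrow> l x"
    using bounded_seq_pointwise_subseq[of m u C, OF assms u] by (auto simp: o_def)
  have "(u \<circ> r) n \<in> \<H>" "\<H>_norm ((u \<circ> r) n) \<le> C" for n using u by auto
  from \<H>.pointwise_limit_is_weak_limit[of "u \<circ> r" C l, OF this r(2)] r(1)
  show "\<exists>r l. strict_mono r \<and> l \<in> \<H> \<and> weakly_converges_in \<H> \<H>_norm (u \<circ> r) l" by blast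
qed

theorem compactly_embedded_H_space_Lp:
  fixes p :: ereal
  assumes k: "(\<lambda>x. \<mu> x / (a x + 1)) summable_on UNIV"
    and m: "0 < m" "\<And>x. m \<le> \<mu> x" and p: "1 \<le> p"
  shows "compactly_embedded \<H> \<H>_norm (Lp_space \<mu> UNIV p) (Lp_norm \<mu> UNIV p)"
proof -
  obtain K where Lp: "\<And>u. (\<lambda>x. \<mu> x * \<bar>u x\<bar>) summable_on UNIV \<Longrightarrow>
      u \<in> Lp_space \<mu> UNIV p \<and> 0 \<le> Lp_norm \<mu> UNIV p u \<and>
      Lp_norm \<mu> UNIV p u \<le> K * (\<Sum>\<^sub>\<infinity>x. \<mu> x * \<bar>u x\<bar>)"
    using L1_imp_Lp[of m \<mu> p, OF m p] by blast
  define T where "T = sqrt (\<Sum>\<^sub>\<infinity>x. \<mu> x / (a x + 1))"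
  have L1: "(\<lambda>x. \<mu> x * \<bar>u x\<bar>) summable_on UNIV" "(\<Sum>\<^sub>\<infinity>x. \<mu> x * \<bar>u x\<bar>) \<le> T * \<H>_norm u"
    if "u \<in> \<H>" for u
    using L1_le_H_norm[OF k that] by (auto simp: T_def)
  have "Lp_norm \<mu> UNIV p u \<le> \<bar>K\<bar> * T * \<H>_norm u" if u: "u \<in> \<H>" for u
  proof -
    have "0 \<le> (\<Sum>\<^sub>\<infinity>x. \<mu> x * \<bar>u x\<bar>)"
      using measure_pos by (intro infsum_nonneg) (simp add: less_imp_le)
    then have "Lp_norm \<mu> UNIV p u \<le> \<bar>K\<bar> * (\<Sum>\<^sub>\<infinity>x. \<mu> x * \<bar>u x\<bar>)"
      using Lp[OF L1(1)[OF u]] by (meson abs_ge_self mult_right_mono order_trans)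
    also have "\<dots> \<le> \<bar>K\<bar> * (T * \<H>_norm u)"
      using L1(2)[OF u] by (intro mult_left_mono) auto
    finally show ?thesis by (simp add: mult.assoc)
  qed
  moreover have "\<H> \<subseteq> Lp_space \<mu> UNIV p" using Lp L1(1) by blast
  moreover have "\<exists>r l. strict_mono r \<and> l \<in> Lp_space \<mu> UNIV p \<and>
      (\<lambda>n. Lp_norm \<mu> UNIV p (\<lambda>x. (u \<circ> r) n x - l x)) \<longlonglongrightarrow> 0"
    if bounded: "bounded_seq_in \<H> \<H>_norm u" for u
  proof -
    obtain C where u: "\<And>n. u n \<in> \<H>" "\<And>n. \<H>_norm (u n) \<le> C"
      using bounded unfolding bounded_seq_in_def by blast
    obtain r l where r: "strict_mono (r :: nat \<Rightarrow> nat)" and lim: "\<And>x. (\<lambda>n. u (r n) x) \<longlonglongrightarrow> l x"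
      using bounded_seq_pointwise_subseq[of m u C, OF k m u] by blast
    have l: "l \<in> \<H>"
      by (rule \<H>.mazur_midpoints(1)[of "\<lambda>n. u (r n)" C l, OF u lim])
    define w where "w n = (\<lambda>x. u (r n) x - l x)" for n
    have w: "w n \<in> \<H>" for n unfolding w_def by (intro \<H>.diff_mem u l)
    have "(\<H>_norm (w n))\<^sup>2 \<le> 2 * C\<^sup>2 + 2 * (\<H>_norm l)\<^sup>2" for n
      using \<H>.norm_diff_sq_le[OF u(1) l, of "r n"]
        power_mono[OF u(2) \<H>.norm_nonneg[OF u(1)], of "r n" 2] by (simp add: w_def)
    then have w_bound: "\<H>_norm (w n) \<le> sqrt (2 * C\<^sup>2 + 2 * (\<H>_norm l)\<^sup>2)" for n
      by (rule real_le_rsqrt)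
    have "(\<lambda>n. w n x) \<longlonglongrightarrow> 0" for x
      unfolding w_def using lim by (rule LIM_zero)
    then have "(\<lambda>n. \<Sum>\<^sub>\<infinity>x. \<mu> x * \<bar>w n x\<bar>) \<longlonglongrightarrow> 0"
      by (rule pointwise_null_imp_L1_null[OF k w w_bound])
    then have L1_null: "(\<lambda>n. K * (\<Sum>\<^sub>\<infinity>x. \<mu> x * \<bar>w n x\<bar>)) \<longlonglongrightarrow> 0"
      by (rule tendsto_mult_right_zero)
    have "(\<lambda>n. Lp_norm \<mu> UNIV p (w n)) \<longlonglongrightarrow> 0"
      by (rule tendsto_sandwich[OF _ _ tendsto_const L1_null]) (use Lp[OF L1(1)[OF w]] in auto)
    then show ?thesis using r Lp[OF L1(1)[OF l]] by (auto simp: w_def)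
  qed
  ultimately show ?thesis unfolding compactly_embedded_def by blast
qed

end

text \<open>
  The sublevel set \<open>a \<le> M0\<close> has finite volume and atoms bounded below, so it is finite; above the level
  \<open>M0 > 0\<close> the weight is dominated by \<open>\<mu> / a\<close>.
\<close>

lemma finite_volume_sublevel_imp_summable:
  fixes \<mu> a :: "'v \<Rightarrow> real"
  assumes m: "0 < m" "\<And>x. m \<le> \<mu> x" and a: "\<And>x. 0 < a x + 1" and "0 < M0"
    and inv: "(\<lambda>x. 1 / a x) \<in> Lp_space \<mu> (UNIV - {x. a x \<le> M0}) 1"
    and vol: "\<mu> summable_on {x. a x \<le> M0}"
  shows "(\<lambda>x. \<mu> x / (a x + 1)) summable_on UNIV"
proof -
  have mu: "0 < \<mu> x" for x using m(1) m(2)[of x] by linarith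
  have "finite {x. a x \<le> M0}"
    using finite_summable_on_ge[OF vol m(1)] m(2) by blast
  then have "(\<lambda>x. \<mu> x / (a x + 1)) summable_on {x. a x \<le> M0}" by simp
  moreover have "(\<lambda>x. \<mu> x / (a x + 1)) summable_on (UNIV - {x. a x \<le> M0})"
  proof (rule summable_on_comparison_test)
    show "(\<lambda>x. \<mu> x * \<bar>1 / a x\<bar>) summable_on (UNIV - {x. a x \<le> M0})"
      using inv by (simp add: Lp_space_def integrable_V_def)
    show "\<mu> x / (a x + 1) \<le> \<mu> x * \<bar>1 / a x\<bar>" if "x \<in> UNIV - {x. a x \<le> M0}" for x
      using that \<open>0 < M0\<close> mu[of x] by (simp add: frac_le)
    show "0 \<le> \<mu> x / (a x + 1)" for x using mu[of x] a[of x] by simp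
  qed
  ultimately have "(\<lambda>x. \<mu> x / (a x + 1)) summable_on ({x. a x \<le> M0} \<union> (UNIV - {x. a x \<le> M0}))"
    by (intro summable_on_Un_disjoint) auto
  then show ?thesis by simp
qed

theorem lemma4:
  fixes E :: "('v \<times> 'v) set"
    and \<omega> :: "'v \<Rightarrow> 'v \<Rightarrow> real"
    and \<mu> a :: "'v \<Rightarrow> real"
    and \<mu>_min a0 :: real
  assumes sym: "sym E"
    and locally_finite: "\<forall>x. finite (E `` {x})"
    and connected: "\<forall>x y. (x, y) \<in> E\<^sup>*"
    and weights: "\<forall>x y. (x, y) \<in> E \<longrightarrow> \<omega> x y = \<omega> y x \<and> \<omega> x y > 0"
    and measure: "\<mu>_min > 0" "\<forall>x. \<mu> x \<ge> \<mu>_min"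
    and A1: "-1 < a0" "a0 < 0" "\<forall>x. a x \<ge> a0"
    and A2': "\<exists>M0>0. (\<lambda>x. 1 / a x) \<in> Lp_space \<mu> (UNIV - {x. a x \<le> M0}) 1 \<and>
                     \<mu> summable_on {x. a x \<le> M0}"
  shows "weakly_precompact (H_space E \<omega> \<mu> a) (H_norm E \<omega> \<mu> a) \<and>
         (\<forall>p::ereal. 1 \<le> p \<longrightarrow>
            compactly_embedded (H_space E \<omega> \<mu> a) (H_norm E \<omega> \<mu> a)
              (Lp_space \<mu> UNIV p) (Lp_norm \<mu> UNIV p))"
proof -
  have mu: "0 < \<mu> x" for x using measure by (meson less_le_trans)
  interpret weighted_graph_potential E \<omega> \<mu> a a0
    using sym locally_finite weights A1 mu by unfold_locales auto
  have "0 < a x + 1" for x using A1(1) A1(3)[rule_format, of x] by linarith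
  then have "(\<lambda>x. \<mu> x / (a x + 1)) summable_on UNIV"
    using A2' measure finite_volume_sublevel_imp_summable[of \<mu>_min \<mu> a] by blast
  then show ?thesis
    using weakly_precompact_H_space compactly_embedded_H_space_Lp measure by blast
qed

end
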